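(* Let $\widetilde A_1$ be bounded, let $\Gamma$ be a $K_B$-bounded contour, and write $d_0(\Gamma):=\operatorname{dist}\{\sigma(\widetilde A_1),\Gamma\}>0$ and $$\mathrm{Var}_{\widetilde A_1}(B,\Gamma):=\int_\Gamma|d\mu|\,\frac{\|K_B'(\mu)\|}{\operatorname{dist}\{\mu,\sigma(\widetilde A_1)\}}.$$ Suppose that $$\mathrm{Var}_{\widetilde A_1}(B,\Gamma)<1,\qquad \mathrm{Var}_{\widetilde A_1}(B,\Gamma)\,\|\widetilde A_1\|<\tfrac14\,d_0(\Gamma)\,[1-\mathrm{Var}_{\widetilde A_1}(B,\Gamma)]^2 .$$ Let $$r_{\min}(\Gamma):=\tfrac12 d_0(\Gamma)[1-\mathrm{Var}_{\widetilde A_1}(B,\Gamma)]-\sqrt{\tfrac14 d_0^2(\Gamma)[1-\mathrm{Var}_{\widetilde A_1}(B,\Gamma)]^2-d_0(\Gamma)\,\mathrm{Var}_{\widetilde A_1}(B,\Gamma)\,\|\widetilde A_1\|}$$ and $$r_{\max}(\Gamma):=d_0(\Gamma)-\sqrt{\mathrm{Var}_{\widetilde A_1}(B,\Gamma)\,d_0(\Gamma)\,[d_0(\Gamma)+\|\widetilde A_1\|]}.$$ Then the equation $$X=V_1(\widetilde A_1+X,\Gamma)$$ is uniquely solvable in any closed ball $\mathcal S_1(r):=\{X\in\mathbf B(\mathcal H_1,\mathcal H_1):\|X\|\le r\}$ where $$r_{\min}(\Gamma)\le r<r_{\max}(\Gamma).$$ The solution $X$ is the same for any $r$ satisfying these inequalities,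 and in fact it belongs to the smallest ball $\mathcal S_1(r_{\min}(\Gamma))$, i.e. $\|X\|\le r_{\min}(\Gamma)$.
   Context: Setting. $\mathcal H_0,\mathcal H_1$ are separable Hilbert spaces; $\mathbf B(\mathcal H_1,\mathcal H_1)$ is the space of bounded operators in $\mathcal H_1$. $A_0$ is an unbounded selfadjoint operator in $\mathcal H_0$ whose spectrum is absolutely continuous and equal to $\Delta_0=[\alpha_0,+\infty)$, $\alpha_0>0$. $A_1$ is a bounded selfadjoint operator in $\mathcal H_1$. The (possibly unbounded) operators $T_{ij}:\mathcal H_j\to\mathcal H_i$ ($i,j\in\{0,1\}$, $i\ne j$) satisfy $T_{01}^*=T_{10}$ and $\mathcal D(T_{10})\supset\mathcal D(A_0^{1/2})$. Then $B_{10}:=T_{10}A_0^{-1/2}$ is bounded; put $B_{01}:=B_{10}^*$. Let $\widetilde A_1:=A_1-B_{10}B_{01}$, a bounded selfadjoint operator in $\mathcal H_1$; it is assumed that $\sigma(\widetilde A_1)\subset\Delta_0$. The function $K_B$. Let $E_0$ be the spectral measure of $A_0$, $E^0(\mu):=E_0([\alpha_0,\mu))$ and $K_B(\mu):=B_{10}E^0(\mu)B_{01}$. It is assumed that: $K_B$ is differentiable on $\Delta_0$ in the operator norm topology; $K_B'$ is continuous within $\Delta_0$ and admits analytic continuation (in the operator norm topology) from $\Delta_0$ to a simply connected domain $D^+\subset\mathbb{C}^+$ (the upper half-plane) whose boundary includes the entire interval $\Delta_0$. Consequently it is also continued to $D^-:=\{z:\overline z\in D^+\}$, and $[K_B'(\mu)]^*=K_B'(\overline\mu)$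 for $\mu\in D^\pm$; the continuations are again denoted $K_B'$. It is assumed that $\|K_B'(\mu)\|\le C|\mu-\alpha_0|^{\gamma}$, $\mu\in D^\pm$, for some $C>0$ and $\gamma\in(-1,0]$. For $l=\pm1$ write $D^l$ for $D^\pm$. Contours. A contour $\Gamma=\Gamma_l$ is a rectifiable Jordan curve in $D^l$ (for $l=+1$ or $l=-1$) resulting from continuous deformation of the interval $\Delta_0$, the finite end point $\alpha_0$ being fixed (oriented from $\alpha_0$ to infinity). It is called $K_B$-bounded if $\mathrm{Var}_1(B,\Gamma):=\int_{\Gamma}|d\mu|\,(1+|\mu|)^{-1}\|K_B'(\mu)\|<\infty$, where $|d\mu|$ is Lebesgue (arc-length) measure on $\Gamma$. It is assumed that $\sigma(\widetilde A_1)$ is separated from $\Gamma$, i.e. $d_0(\Gamma)>0$; then $\mathrm{Var}_{\widetilde A_1}(B,\Gamma)<\infty$. The transformation $V_1$. For a bounded operator $Y$ in $\mathcal H_1$ whose spectrum is separated from $\Gamma$, define the bounded operator $V_1(Y,\Gamma):=\int_\Gamma d\mu\,K_B'(\mu)\,Y(Y-\mu)^{-1}$. *)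

theory Defs
  imports "HOL-Analysis.Analysis"
begin

section \<open>Complex Hilbert spaces\<close>

class complex_vector = real_vector +
  fixes scaleC :: "complex \<Rightarrow> 'a \<Rightarrow> 'a" (infixr "*\<^sub>C" 75)
  assumes scaleC_add_right: "a *\<^sub>C (x + y) = a *\<^sub>C x + a *\<^sub>C y"
    and scaleC_add_left: "(a + b) *\<^sub>C x = a *\<^sub>C x + b *\<^sub>C x"
    and scaleC_scaleC: "a *\<^sub>C b *\<^sub>C x = (a * b) *\<^sub>C x"
    and scaleC_one: "1 *\<^sub>C x = x"
    and scaleR_scaleC: "r *\<^sub>R x = complex_of_real r *\<^sub>C x"

class complex_normed_vector = complex_vector + real_normed_vector +
  assumes norm_scaleC: "norm (a *\<^sub>C x) = cmod a * norm x"

text \<open>The inner product is antilinear in the first and linear in the second argument.\<close>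

class complex_hilbert_space = complex_normed_vector + banach +
  fixes cinner :: "'a \<Rightarrow> 'a \<Rightarrow> complex"
  assumes cinner_commute: "cinner x y = cnj (cinner y x)"
    and cinner_add_right: "cinner x (y + z) = cinner x y + cinner x z"
    and cinner_scaleC_right: "cinner x (a *\<^sub>C y) = a * cinner x y"
    and cinner_self: "cinner x x = complex_of_real ((norm x)\<^sup>2)"

lemma scaleC_zero_right [simp]: "a *\<^sub>C (0::'a::complex_vector) = 0"
  using scaleC_add_right[of a 0 "0::'a"] by simp

lemma scaleC_minus_right: "a *\<^sub>C (- x) = - (a *\<^sub>C (x::'a::complex_vector))"
  using scaleC_add_right[of a x "- x"] by (simp add: eq_neg_iff_add_eq_0 add.commute)

lemma scaleC_diff_right: "a *\<^sub>C (x - y) = a *\<^sub>C x - a *\<^sub>C (y::'a::complex_vector)"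
  using scaleC_add_right[of a x "- y"] by (simp add: scaleC_minus_right)

lemma scaleC_scaleR_commute: "a *\<^sub>C r *\<^sub>R x = r *\<^sub>R a *\<^sub>C (x::'a::complex_vector)"
  by (simp add: scaleR_scaleC scaleC_scaleC mult.commute)

lemma bounded_linear_scaleC: "bounded_linear (\<lambda>x::'a::complex_normed_vector. a *\<^sub>C x)"
  by (rule bounded_linear_intro[where K = "cmod a"])
    (auto simp: scaleC_add_right scaleC_scaleR_commute norm_scaleC mult.commute)


section \<open>Bounded operators\<close>

definition bounded_clinear :: "('a::complex_normed_vector \<Rightarrow> 'b::complex_normed_vector) \<Rightarrow> bool" where
  "bounded_clinear f \<longleftrightarrow> bounded_linear f \<and> (\<forall>c x. f (c *\<^sub>C x) = c *\<^sub>C f x)"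

typedef (overloaded) ('a, 'b) bop =
  "{f :: 'a::complex_normed_vector \<Rightarrow> 'b::complex_normed_vector. bounded_clinear f}"
  morphisms bop_apply Bop
  by (rule exI[where x = "\<lambda>x. 0"]) (simp add: bounded_clinear_def bounded_linear_zero)

setup_lifting type_definition_bop

lemma bop_eqI: "(\<And>x. bop_apply A x = bop_apply B x) \<Longrightarrow> A = B"
  by (metis bop_apply_inject ext)

lemma bounded_linear_bop_apply: "bounded_linear (bop_apply A)"
  using bop_apply[of A] by (simp add: bounded_clinear_def)

lemma bop_apply_scaleC: "bop_apply A (c *\<^sub>C x) = c *\<^sub>C bop_apply A x"
  using bop_apply[of A] by (simp add: bounded_clinear_def)

instantiation bop :: (complex_normed_vector, complex_normed_vector) real_normed_vector
begin

lift_definition norm_bop :: "('a, 'b) bop \<Rightarrow> real" is onorm .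

lift_definition zero_bop :: "('a, 'b) bop" is "\<lambda>x. 0"
  by (simp add: bounded_clinear_def bounded_linear_zero)

lift_definition plus_bop :: "('a, 'b) bop \<Rightarrow> ('a, 'b) bop \<Rightarrow> ('a, 'b) bop" is "\<lambda>f g x. f x + g x"
  by (simp add: bounded_clinear_def bounded_linear_add scaleC_add_right)

lift_definition uminus_bop :: "('a, 'b) bop \<Rightarrow> ('a, 'b) bop" is "\<lambda>f x. - f x"
  by (simp add: bounded_clinear_def bounded_linear_minus scaleC_minus_right)

lift_definition minus_bop :: "('a, 'b) bop \<Rightarrow> ('a, 'b) bop \<Rightarrow> ('a, 'b) bop" is "\<lambda>f g x. f x - g x"
  by (simp add: bounded_clinear_def bounded_linear_sub scaleC_diff_right)

lift_definition scaleR_bop :: "real \<Rightarrow> ('a, 'b) bop \<Rightarrow> ('a, 'b) bop" is "\<lambda>r f x. r *\<^sub>R f x"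
  by (auto simp: bounded_clinear_def scaleC_scaleR_commute
      intro: bounded_linear_compose[OF bounded_linear_scaleR_right])

definition dist_bop :: "('a, 'b) bop \<Rightarrow> ('a, 'b) bop \<Rightarrow> real" where
  "dist_bop A B = norm (A - B)"

definition [code del]:
  "(uniformity :: (('a, 'b) bop \<times> ('a, 'b) bop) filter) =
    (INF e\<in>{0 <..}. principal {(x, y). dist x y < e})"

definition open_bop :: "('a, 'b) bop set \<Rightarrow> bool" where [code del]:
  "open_bop S = (\<forall>x\<in>S. \<forall>\<^sub>F (x', y) in uniformity. x' = x \<longrightarrow> y \<in> S)"

definition sgn_bop :: "('a, 'b) bop \<Rightarrow> ('a, 'b) bop" where
  "sgn_bop x = scaleR (inverse (norm x)) x"

instance
proof
  fix A B C :: "('a, 'b) bop" and r s :: real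
  show "A + B + C = A + (B + C)" "A + B = B + A" "0 + A = A" "- A + A = 0" "A - B = A + - B"
    by (transfer; simp add: algebra_simps)+
  show "r *\<^sub>R (A + B) = r *\<^sub>R A + r *\<^sub>R B" "(r + s) *\<^sub>R A = r *\<^sub>R A + s *\<^sub>R A"
    "r *\<^sub>R s *\<^sub>R A = (r * s) *\<^sub>R A" "1 *\<^sub>R A = A"
    by (transfer; simp add: algebra_simps)+
  show "dist A B = norm (A - B)" by (rule dist_bop_def)
  show "sgn A = inverse (norm A) *\<^sub>R A" by (rule sgn_bop_def)
  show "uniformity = (INF e\<in>{0 <..}. principal {(x, y :: ('a, 'b) bop). dist x y < e})"
    by (rule uniformity_bop_def)
  show "open U = (\<forall>x\<in>U. \<forall>\<^sub>F (x', y) in uniformity. x' = x \<longrightarrow> y \<in> U)" for U :: "('a, 'b) bop set"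
    by (rule open_bop_def)
  show "(norm A = 0) = (A = 0)"
    by transfer (auto simp: bounded_clinear_def onorm_eq_0)
  show "norm (A + B) \<le> norm A + norm B"
    by transfer (auto simp: bounded_clinear_def onorm_triangle)
  show "norm (r *\<^sub>R A) = \<bar>r\<bar> * norm A"
    by transfer (auto simp: bounded_clinear_def onorm_scaleR)
qed

end

instantiation bop :: (complex_normed_vector, complex_normed_vector) complex_normed_vector
begin

lift_definition scaleC_bop :: "complex \<Rightarrow> ('a, 'b) bop \<Rightarrow> ('a, 'b) bop" is "\<lambda>c f x. c *\<^sub>C f x"
  by (auto simp: bounded_clinear_def scaleC_scaleC mult.commute
      intro: bounded_linear_compose[OF bounded_linear_scaleC])

instance
proof
  fix A B :: "('a, 'b) bop" and r :: real and a b :: complex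
  show "a *\<^sub>C (A + B) = a *\<^sub>C A + a *\<^sub>C B" "(a + b) *\<^sub>C A = a *\<^sub>C A + b *\<^sub>C A"
    "a *\<^sub>C b *\<^sub>C A = (a * b) *\<^sub>C A" "1 *\<^sub>C A = A" "r *\<^sub>R A = complex_of_real r *\<^sub>C A"
    by (transfer; simp add: scaleC_add_right scaleC_add_left scaleC_scaleC scaleC_one scaleR_scaleC)+
  show "norm (a *\<^sub>C A) = cmod a * norm A"
  proof transfer
    fix a :: complex and f :: "'a \<Rightarrow> 'b"
    assume "bounded_clinear f"
    then have f: "bounded_linear f" by (simp add: bounded_clinear_def)
    have "onorm (\<lambda>x. a *\<^sub>C f x) = onorm (\<lambda>x. cmod a *\<^sub>R f x)"
      by (simp add: onorm_def norm_scaleC)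
    then show "onorm (\<lambda>x. a *\<^sub>C f x) = cmod a * onorm f"
      using onorm_scaleR[OF f] by simp
  qed
qed

end

lemma norm_bop_apply_le: "norm (bop_apply A x) \<le> norm A * norm x"
  by transfer (auto simp: bounded_clinear_def intro: onorm)

instance bop :: (complex_normed_vector, "{complex_normed_vector, banach}") banach
proof
  fix X :: "nat \<Rightarrow> ('a, 'b) bop"
  assume X: "Cauchy X"
  have norm_Blinfun: "norm (Blinfun (bop_apply A)) = norm A" for A :: "('a, 'b) bop"
    by (simp add: norm_blinfun.rep_eq norm_bop.rep_eq bounded_linear_Blinfun_apply
        bounded_linear_bop_apply)
  have Blinfun_diff: "Blinfun (bop_apply A) - Blinfun (bop_apply B) = Blinfun (bop_apply (A - B))"
    for A B :: "('a, 'b) bop"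
    by (rule blinfun_eqI)
      (simp only: blinfun.diff_left bounded_linear_Blinfun_apply[OF bounded_linear_bop_apply],
        simp only: minus_bop.rep_eq)
  have "Cauchy (\<lambda>n. Blinfun (bop_apply (X n)))"
    using X unfolding Cauchy_def dist_norm by (simp add: Blinfun_diff norm_Blinfun)
  then obtain L where L: "(\<lambda>n. Blinfun (bop_apply (X n))) \<longlonglongrightarrow> L"
    using Cauchy_convergent convergent_def by blast
  have pt: "(\<lambda>n. bop_apply (X n) x) \<longlonglongrightarrow> blinfun_apply L x" for x
    using blinfun.tendsto[OF L tendsto_const[of x]]
    by (simp add: bounded_linear_Blinfun_apply bounded_linear_bop_apply)
  have "blinfun_apply L (c *\<^sub>C x) = c *\<^sub>C blinfun_apply L x" for c x
  proof (rule LIMSEQ_unique)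
    show "(\<lambda>n. bop_apply (X n) (c *\<^sub>C x)) \<longlonglongrightarrow> blinfun_apply L (c *\<^sub>C x)" by (rule pt)
    show "(\<lambda>n. bop_apply (X n) (c *\<^sub>C x)) \<longlonglongrightarrow> c *\<^sub>C blinfun_apply L x"
      using bounded_linear.tendsto[OF bounded_linear_scaleC pt] by (simp add: bop_apply_scaleC)
  qed
  then have "bounded_clinear (blinfun_apply L)"
    by (simp add: bounded_clinear_def blinfun.bounded_linear_right)
  then have L_eq: "L = Blinfun (bop_apply (Bop (blinfun_apply L)))"
    by (simp add: Bop_inverse blinfun_apply_inverse)
  have "X \<longlonglongrightarrow> Bop (blinfun_apply L)"
    using L unfolding LIMSEQ_def dist_norm
    by (subst (asm) L_eq) (simp add: Blinfun_diff norm_Blinfun)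
  then show "convergent X" by (auto simp: convergent_def)
qed

lift_definition bop_id :: "('a::complex_normed_vector, 'a) bop" is "\<lambda>x. x"
  by (simp add: bounded_clinear_def bounded_linear_ident)

lift_definition bop_compose ::
  "('b::complex_normed_vector, 'c::complex_normed_vector) bop \<Rightarrow>
   ('a::complex_normed_vector, 'b) bop \<Rightarrow> ('a, 'c) bop" (infixl "\<circ>\<^sub>B" 67) is "\<lambda>f g x. f (g x)"
  by (auto simp: bounded_clinear_def intro: bounded_linear_compose)


section \<open>Unbounded operators\<close>

text \<open>
  A possibly unbounded operator is its graph, a set of pairs \<open>(x, T x)\<close>. Its domain is
  \<^const>\<open>Domain\<close>, the product \<open>T S\<close> (first \<open>S\<close>, then \<open>T\<close>) is \<open>S O T\<close>, and the inverse of an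
  injective operator is the converse relation.
\<close>

definition is_operator :: "('a::complex_vector \<times> 'b::complex_vector) set \<Rightarrow> bool" where
  "is_operator T \<longleftrightarrow> single_valued T \<and> (0, 0) \<in> T \<and>
    (\<forall>(x, y)\<in>T. \<forall>(x', y')\<in>T. (x + x', y + y') \<in> T) \<and>
    (\<forall>c. \<forall>(x, y)\<in>T. (c *\<^sub>C x, c *\<^sub>C y) \<in> T)"

definition densely_defined :: "('a::topological_space \<times> 'b) set \<Rightarrow> bool" where
  "densely_defined T \<longleftrightarrow> closure (Domain T) = UNIV"

definition op_adjoint ::
  "('a::complex_hilbert_space \<times> 'b::complex_hilbert_space) set \<Rightarrow> ('b \<times> 'a) set" where
  "op_adjoint T = {(y, z). \<forall>(x, w)\<in>T. cinner y w = cinner z x}"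

definition op_selfadjoint :: "('a::complex_hilbert_space \<times> 'a) set \<Rightarrow> bool" where
  "op_selfadjoint T \<longleftrightarrow> is_operator T \<and> densely_defined T \<and> op_adjoint T = T"

definition graph :: "('a::complex_normed_vector, 'b::complex_normed_vector) bop \<Rightarrow> ('a \<times> 'b) set" where
  "graph A = {(x, bop_apply A x) | x. True}"

definition the_bop :: "('a::complex_normed_vector \<times> 'b::complex_normed_vector) set \<Rightarrow> ('a, 'b) bop" where
  "the_bop T = (THE A. graph A = T)"

definition adj ::
  "('a::complex_hilbert_space, 'b::complex_hilbert_space) bop \<Rightarrow> ('b, 'a) bop" where
  "adj A = the_bop (op_adjoint (graph A))"

definition bop_inverse :: "('a::complex_normed_vector, 'a) bop \<Rightarrow> ('a, 'a) bop" where
  "bop_inverse A = the_bop ((graph A)\<inverse>)"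

definition op_shift :: "('a::complex_vector \<times> 'a) set \<Rightarrow> complex \<Rightarrow> ('a \<times> 'a) set" where
  "op_shift T z = {(x, y - z *\<^sub>C x) | x y. (x, y) \<in> T}"

definition op_spectrum :: "('a::complex_normed_vector \<times> 'a) set \<Rightarrow> complex set" where
  "op_spectrum T = {z. \<nexists>R. graph R = (op_shift T z)\<inverse>}"

abbreviation spectrum :: "('a::complex_normed_vector, 'a) bop \<Rightarrow> complex set" where
  "spectrum A \<equiv> op_spectrum (graph A)"


section \<open>Spectral measures\<close>

definition projection_valued_measure ::
  "(real set \<Rightarrow> ('a::complex_hilbert_space, 'a) bop) \<Rightarrow> bool" where
  "projection_valued_measure E \<longleftrightarrow>
    (\<forall>S\<in>sets borel. E S \<circ>\<^sub>B E S = E S \<and> adj (E S) = E S) \<and>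
    E UNIV = bop_id \<and>
    (\<forall>F :: nat \<Rightarrow> real set. range F \<subseteq> sets borel \<and> disjoint_family F \<longrightarrow>
      (\<forall>x. (\<lambda>n. bop_apply (E (F n)) x) sums bop_apply (E (\<Union>n. F n)) x))"

text \<open>The scalar measure \<open>S \<mapsto> \<langle>x, E S x\<rangle> = \<parallel>E S x\<parallel>\<^sup>2\<close>.\<close>

definition spectral_distribution ::
  "(real set \<Rightarrow> ('a::complex_hilbert_space, 'a) bop) \<Rightarrow> 'a \<Rightarrow> real measure" where
  "spectral_distribution E x =
    measure_of UNIV (sets borel) (\<lambda>S. ennreal ((norm (bop_apply (E S) x))\<^sup>2))"

definition spectral_domain ::
  "(real set \<Rightarrow> ('a::complex_hilbert_space, 'a) bop) \<Rightarrow> (real \<Rightarrow> real) \<Rightarrow> 'a set" where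
  "spectral_domain E f = {x. integrable (spectral_distribution E x) (\<lambda>t. (f t)\<^sup>2)}"

text \<open>
  The integral of \<open>f\<close> against the complex measure \<open>S \<mapsto> \<langle>z, E S x\<rangle>\<close>, expressed through the positive
  measures of \<^const>\<open>spectral_distribution\<close> by the polarization identity
  \<open>4 \<langle>z, P x\<rangle> = (\<Sum>k<4. \<i> ^ k * \<parallel>P (x + \<i> ^ k z)\<parallel>\<^sup>2)\<close>, see \<open>projection_polarization\<close> below.
\<close>

definition spectral_form ::
  "(real set \<Rightarrow> ('a::complex_hilbert_space, 'a) bop) \<Rightarrow> (real \<Rightarrow> real) \<Rightarrow> 'a \<Rightarrow> 'a \<Rightarrow> complex" where
  "spectral_form E f z x =
    (\<Sum>k<4. \<i> ^ k * complex_of_real (\<integral>t. f t \<partial>spectral_distribution E (x + (\<i> ^ k) *\<^sub>C z))) / 4"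

text \<open>
  The (generally unbounded) operator \<open>\<integral> f dE\<close> for a Borel function \<open>f\<close>. As its domain is dense,
  the condition on \<open>y\<close> determines \<open>y = (\<integral> f dE) x\<close> uniquely.
\<close>

definition spectral_integral ::
  "(real set \<Rightarrow> ('a::complex_hilbert_space, 'a) bop) \<Rightarrow> (real \<Rightarrow> real) \<Rightarrow> ('a \<times> 'a) set" where
  "spectral_integral E f = {(x, y). x \<in> spectral_domain E f \<and>
    (\<forall>z\<in>spectral_domain E f. cinner z y = spectral_form E f z x)}"

definition spectral_measure_of ::
  "(real set \<Rightarrow> ('a::complex_hilbert_space, 'a) bop) \<Rightarrow> ('a \<times> 'a) set \<Rightarrow> bool" where
  "spectral_measure_of E A \<longleftrightarrow> projection_valued_measure E \<and> spectral_integral E (\<lambda>t. t) = A"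

lemma cinner_add_left: "cinner (x + y) z = cinner x z + cinner y (z::'a::complex_hilbert_space)"
  by (metis cinner_commute cinner_add_right complex_cnj_add)

lemma cinner_scaleC_left: "cinner (a *\<^sub>C x) y = cnj a * cinner x (y::'a::complex_hilbert_space)"
  by (metis cinner_commute cinner_scaleC_right complex_cnj_mult)

lemma projection_polarization:
  assumes sym: "\<And>u v. cinner (bop_apply P u) v = cinner u (bop_apply P v)"
    and idem: "P \<circ>\<^sub>B P = P"
  shows "cinner z (bop_apply P x) =
    (\<Sum>k<4. \<i> ^ k * complex_of_real ((norm (bop_apply P (x + (\<i> ^ k) *\<^sub>C z)))\<^sup>2)) / 4"
proof -
  have PP: "bop_apply P (bop_apply P u) = bop_apply P u" for u
    using idem by (metis bop_compose.rep_eq)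
  have n: "complex_of_real ((norm (bop_apply P u))\<^sup>2) = cinner u (bop_apply P u)" for u
    by (metis cinner_self sym PP)
  have add: "bop_apply P (u + v) = bop_apply P u + bop_apply P v" for u v
    by (rule linear_add[OF bounded_linear.linear[OF bounded_linear_bop_apply]])
  show ?thesis
    unfolding n
    by (simp add: eval_nat_numeral lessThan_Suc add bop_apply_scaleC cinner_add_left
        cinner_add_right cinner_scaleC_left cinner_scaleC_right scaleC_one) (simp add: algebra_simps)
qed


section \<open>The function \<open>K\<^sub>B\<close> and its continuation\<close>

text \<open>\<open>B\<^sub>1\<^sub>0 = T\<^sub>1\<^sub>0 A\<^sub>0\<^sup>-\<^sup>1\<^sup>/\<^sup>2\<close>, where \<open>E\<close> is the spectral measure of \<open>A\<^sub>0\<close>.\<close>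

definition B10_of ::
  "(real set \<Rightarrow> ('a::complex_hilbert_space, 'a) bop) \<Rightarrow> ('a \<times> 'b::complex_hilbert_space) set \<Rightarrow>
   ('a, 'b) bop" where
  "B10_of E T10 = the_bop ((spectral_integral E sqrt)\<inverse> O T10)"

definition K_B ::
  "(real set \<Rightarrow> ('a::complex_hilbert_space, 'a) bop) \<Rightarrow> real \<Rightarrow>
   ('a, 'b::complex_hilbert_space) bop \<Rightarrow> real \<Rightarrow> ('b, 'b) bop" where
  "K_B E \<alpha>\<^sub>0 B \<mu> = B \<circ>\<^sub>B E {\<alpha>\<^sub>0..<\<mu>} \<circ>\<^sub>B adj B"

definition vec_holomorphic_on ::
  "(complex \<Rightarrow> 'a::complex_normed_vector) \<Rightarrow> complex set \<Rightarrow> bool" where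
  "vec_holomorphic_on f S \<longleftrightarrow>
    (\<forall>z\<in>S. \<exists>d. ((\<lambda>w. inverse (w - z) *\<^sub>C (f w - f z)) \<longlongrightarrow> d) (at z within S))"

text \<open>
  \<open>K'\<close> is the derivative of \<open>K\<close> on \<open>(\<alpha>\<^sub>0, \<infinity>)\<close> together with its continuation to \<open>D = D\<^sup>+\<close> and to the
  mirror image \<open>D\<^sup>-\<close>. The real points are boundary points of \<open>D\<close>, so the continuation is meant in
  the sense of boundary values: analytic in \<open>D\<close>, continuous up to the real points.
  Nothing is required at the end point \<open>\<alpha>\<^sub>0\<close> itself: a derivative of order
  \<open>\<bar>\<mu> - \<alpha>\<^sub>0\<bar> powr g\<close> with \<open>g < 0\<close> is singular there.
\<close>

definition continued_derivative ::
  "(real \<Rightarrow> ('b::complex_hilbert_space, 'b) bop) \<Rightarrow> real \<Rightarrow> complex set \<Rightarrow>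
   (complex \<Rightarrow> ('b, 'b) bop) \<Rightarrow> bool" where
  "continued_derivative K \<alpha>\<^sub>0 D K' \<longleftrightarrow>
    (\<forall>\<mu>>\<alpha>\<^sub>0. (K has_vector_derivative K' (complex_of_real \<mu>)) (at \<mu>)) \<and>
    continuous_on (D \<union> complex_of_real ` {\<alpha>\<^sub>0<..}) K' \<and>
    vec_holomorphic_on K' D \<and>
    (\<forall>\<mu>\<in>D. K' (cnj \<mu>) = adj (K' \<mu>))"


section \<open>Contours\<close>

definition curve_length :: "(real \<Rightarrow> complex) \<Rightarrow> real \<Rightarrow> real \<Rightarrow> ennreal" where
  "curve_length \<gamma> a b =
    (SUP d\<in>{d. d division_of {a..b}}. \<Sum>k\<in>d. ennreal (cmod (\<gamma> (Sup k) - \<gamma> (Inf k))))"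

text \<open>
  A contour is a locally rectifiable Jordan arc from \<open>\<alpha>\<^sub>0\<close> to infinity, given by its arc length
  parametrization \<open>\<gamma>\<close> on \<open>[0, \<infinity>)\<close>, so that \<open>|d\<mu>|\<close> corresponds to Lebesgue measure on \<open>[0, \<infinity>)\<close>.
  All its points other than \<open>\<alpha>\<^sub>0\<close> lie in \<open>D\<close>. The deformation fixes \<open>\<alpha>\<^sub>0\<close>, runs within
  \<open>D \<union> [\<alpha>\<^sub>0, \<infinity>)\<close> and keeps the other end of the curve at infinity.
\<close>

definition is_contour :: "real \<Rightarrow> complex set \<Rightarrow> (real \<Rightarrow> complex) \<Rightarrow> bool" where
  "is_contour \<alpha>\<^sub>0 D \<gamma> \<longleftrightarrow>
    (\<forall>t\<ge>0. curve_length \<gamma> 0 t = ennreal t) \<and>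
    inj_on \<gamma> {0..} \<and>
    \<gamma> ` {0<..} \<subseteq> D \<and>
    homotopic_with_canon
      (\<lambda>h. h 0 = complex_of_real \<alpha>\<^sub>0 \<and> filterlim h at_infinity at_top)
      {0..} (D \<union> complex_of_real ` {\<alpha>\<^sub>0..})
      (\<lambda>t. complex_of_real (\<alpha>\<^sub>0 + t)) \<gamma>"

definition arc_integral :: "(real \<Rightarrow> complex) \<Rightarrow> (complex \<Rightarrow> real) \<Rightarrow> ennreal" where
  "arc_integral \<gamma> f = (\<integral>\<^sup>+t\<in>{0<..}. ennreal (f (\<gamma> t)) \<partial>lborel)"

text \<open>
  \<open>\<integral> F(\<mu>) d\<mu>\<close> along \<open>\<gamma>\<close>: the Riemann-Stieltjes integral with respect to \<open>\<gamma>\<close> over compact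
  parameter intervals, and its improper version over \<open>(0, \<infinity>)\<close>; the integrand may be singular at
  the initial point of the contour.
\<close>

definition has_line_integral ::
  "(complex \<Rightarrow> 'a::complex_normed_vector) \<Rightarrow> 'a \<Rightarrow> (real \<Rightarrow> complex) \<Rightarrow> real \<Rightarrow> real \<Rightarrow> bool" where
  "has_line_integral F I \<gamma> a b \<longleftrightarrow>
    (\<forall>e>0. \<exists>\<delta>>0. \<forall>p. p tagged_division_of {a..b} \<and> (\<lambda>t. ball t \<delta>) fine p \<longrightarrow>
      norm ((\<Sum>(t, k)\<in>p. (\<gamma> (Sup k) - \<gamma> (Inf k)) *\<^sub>C F (\<gamma> t)) - I) < e)"

definition has_improper_line_integral ::
  "(complex \<Rightarrow> 'a::complex_normed_vector) \<Rightarrow> 'a \<Rightarrow> (real \<Rightarrow> complex) \<Rightarrow> bool" where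
  "has_improper_line_integral F I \<gamma> \<longleftrightarrow>
    (\<exists>J. (\<forall>a b. 0 < a \<and> a \<le> b \<longrightarrow> has_line_integral F (J a b) \<gamma> a b) \<and>
      ((\<lambda>(a, b). J a b) \<longlongrightarrow> I) (at_right 0 \<times>\<^sub>F at_top))"

definition V1 ::
  "(complex \<Rightarrow> ('b::complex_normed_vector, 'b) bop) \<Rightarrow> (real \<Rightarrow> complex) \<Rightarrow>
   ('b, 'b) bop \<Rightarrow> ('b, 'b) bop" where
  "V1 K' \<gamma> Y = (THE I. has_improper_line_integral
     (\<lambda>\<mu>. K' \<mu> \<circ>\<^sub>B (Y \<circ>\<^sub>B bop_inverse (Y - \<mu> *\<^sub>C bop_id))) I \<gamma>)"

definition K_B_bounded ::
  "(complex \<Rightarrow> ('b::complex_normed_vector, 'b) bop) \<Rightarrow> (real \<Rightarrow> complex) \<Rightarrow> bool" where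
  "K_B_bounded K' \<gamma> \<longleftrightarrow> arc_integral \<gamma> (\<lambda>\<mu>. norm (K' \<mu>) / (1 + cmod \<mu>)) < \<infinity>"

text \<open>Finite for a \<open>K\<^sub>B\<close>-bounded contour separated from the spectrum of \<open>A\<close>.\<close>

definition Var ::
  "(complex \<Rightarrow> ('b::complex_normed_vector, 'b) bop) \<Rightarrow> (real \<Rightarrow> complex) \<Rightarrow>
   ('b, 'b) bop \<Rightarrow> real" where
  "Var K' \<gamma> A = enn2real (arc_integral \<gamma> (\<lambda>\<mu>. norm (K' \<mu>) / infdist \<mu> (spectrum A)))"

definition d\<^sub>0 :: "(real \<Rightarrow> complex) \<Rightarrow> ('b::complex_normed_vector, 'b) bop \<Rightarrow> real" where
  "d\<^sub>0 \<gamma> A = setdist (spectrum A) (\<gamma> ` {0..})"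

definition r_min ::
  "(complex \<Rightarrow> ('b::complex_normed_vector, 'b) bop) \<Rightarrow> (real \<Rightarrow> complex) \<Rightarrow>
   ('b, 'b) bop \<Rightarrow> real" where
  "r_min K' \<gamma> A = d\<^sub>0 \<gamma> A * (1 - Var K' \<gamma> A) / 2 -
    sqrt ((d\<^sub>0 \<gamma> A)\<^sup>2 * (1 - Var K' \<gamma> A)\<^sup>2 / 4 - d\<^sub>0 \<gamma> A * Var K' \<gamma> A * norm A)"

definition r_max ::
  "(complex \<Rightarrow> ('b::complex_normed_vector, 'b) bop) \<Rightarrow> (real \<Rightarrow> complex) \<Rightarrow>
   ('b, 'b) bop \<Rightarrow> real" where
  "r_max K' \<gamma> A = d\<^sub>0 \<gamma> A - sqrt (Var K' \<gamma> A * d\<^sub>0 \<gamma> A * (d\<^sub>0 \<gamma> A + norm A))"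

end

theory Submission
  imports Defs
begin

text \<open>
  Write \<open>A\<close> for the bounded selfadjoint operator \<open>A\<^sub>1 - B\<^sub>1\<^sub>0 B\<^sub>0\<^sub>1\<close>, \<open>d\<close> for its distance to the contour and \<open>V\<close> for
  the variation. The equation is a fixed point problem for \<open>X \<mapsto> V\<^sub>1(A + X)\<close>, to which the contraction
  principle applies on balls of radius \<open>r < r\<^sub>m\<^sub>a\<^sub>x\<close>.

  All estimates start from the resolvent bound \<open>\<parallel>(A - \<mu>)\<^sup>-\<^sup>1\<parallel> \<le> 1 / \<rho>\<close> with \<open>\<rho> = dist(\<mu>, \<sigma>(A))\<close>
  (\<open>symmetric_lower_bound\<close>, proved by an elementary variational argument) and its perturbation
  \<open>\<parallel>(A + X - \<mu>)\<^sup>-\<^sup>1\<parallel> \<le> 1 / (\<rho> - r)\<close> for \<open>\<parallel>X\<parallel> \<le> r < d\<close> (\<open>perturbed_resolvent\<close>). As \<open>\<rho> \<ge> d\<close> on the contour,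
  integration gives \<open>\<parallel>V\<^sub>1(A + X)\<parallel> \<le> V d (\<parallel>A\<parallel> + r) / (d - r)\<close> (\<open>V1_props\<close>), and
  \<open>\<parallel>V\<^sub>1(A + X) - V\<^sub>1(A + Z)\<parallel> \<le> V d (d + \<parallel>A\<parallel>) / (d - r)\<^sup>2 \<parallel>X - Z\<parallel>\<close> (\<open>V1_lipschitz\<close>). The Lipschitz constant is
  less than \<open>1\<close> for \<open>r < r\<^sub>m\<^sub>a\<^sub>x\<close>, and at \<open>r = r\<^sub>m\<^sub>i\<^sub>n\<close> the first bound equals \<open>r\<close>. As \<open>r\<^sub>m\<^sub>i\<^sub>n < r\<^sub>m\<^sub>a\<^sub>x\<close>
  (\<open>radii\<close>), the map has a fixed point in the smallest ball, and it is the only one in every ball of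
  radius less than \<open>r\<^sub>m\<^sub>a\<^sub>x\<close>.

  The integral defining \<open>V\<^sub>1\<close> has to be shown to exist. The contour is merely Lipschitz in its arc length
  parameter, and its operator-valued integrand is continuous. Replacing the integrator by averages
  with continuous derivative, the difference quotients of \<open>\<gamma>\<close>, reduces existence, additivity and the bound
  \<open>\<parallel>\<integral> F d\<mu>\<parallel> \<le> \<integral> \<parallel>F\<parallel> \<bar>d\<mu>\<bar>\<close> over compact parameter intervals to ordinary integrals of continuous functions
  (\<open>has_line_integral_exists\<close>, \<open>norm_line_integral_le\<close>). The improper integral converges because the
  integrand is dominated by a multiple of \<open>\<parallel>K'\<parallel> / \<rho>\<close>, whose integral is \<open>V\<close>.
\<close>


section \<open>Algebra of bounded operators\<close>

lemma bounded_bilinear_scaleC: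
  "bounded_bilinear (\<lambda>a (x::'a::complex_normed_vector). a *\<^sub>C x)"
proof (rule bounded_bilinear.intro)
  show "\<exists>K. \<forall>a (x::'a). norm (a *\<^sub>C x) \<le> norm a * norm x * K"
    by (rule exI[of _ 1]) (simp add: norm_scaleC)
qed (auto simp: scaleC_add_right scaleC_add_left scaleC_scaleR_commute scaleR_scaleC scaleC_scaleC scaleR_conv_of_real
    mult.commute)

lemma bop_apply_simps [simp]:
  "bop_apply (A + B) x = bop_apply A x + bop_apply B x"
  "bop_apply (A - B) x = bop_apply A x - bop_apply B x"
  "bop_apply (- A) x = - bop_apply A x"
  "bop_apply 0 x = 0"
  "bop_apply (c *\<^sub>C A) x = c *\<^sub>C bop_apply A x"
  "bop_apply (r *\<^sub>R A) x = r *\<^sub>R bop_apply A x"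
  "bop_apply bop_id x = x"
  "bop_apply (P \<circ>\<^sub>B A) x = bop_apply P (bop_apply A x)"
  by (transfer; simp)+

lemma bop_apply_linear:
  "bop_apply A (x + y) = bop_apply A x + bop_apply A y"
  "bop_apply A (x - y) = bop_apply A x - bop_apply A y"
  "bop_apply A (- x) = - bop_apply A x"
  "bop_apply A 0 = 0"
  "bop_apply A (r *\<^sub>R x) = r *\<^sub>R bop_apply A x"
  using bounded_linear.linear[OF bounded_linear_bop_apply[of A]]
  by (auto simp: linear_add linear_diff linear_neg linear_0 linear_cmul)

lemma scaleC_minus_left: "(- a) *\<^sub>C x = - (a *\<^sub>C (x::'a::complex_vector))"
  and scaleC_zero_left: "0 *\<^sub>C x = (0::'a::complex_vector)"
proof -
  show z: "0 *\<^sub>C x = (0::'a)" using scaleC_add_left[of 0 0 x] by simp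
  show "(- a) *\<^sub>C x = - (a *\<^sub>C x)"
    using scaleC_add_left[of "- a" a x] by (simp add: z eq_neg_iff_add_eq_0)
qed

lemma norm_bop_le:
  assumes "\<And>x. norm (bop_apply A x) \<le> K * norm x" "0 \<le> K"
  shows "norm A \<le> K"
  using assms by transfer (auto intro: onorm_bound)

lemma norm_bop_compose_le: "norm (A \<circ>\<^sub>B B) \<le> norm A * norm B"
proof (rule norm_bop_le)
  fix x
  have "norm (bop_apply A (bop_apply B x)) \<le> norm A * (norm B * norm x)"
    by (rule order_trans[OF norm_bop_apply_le]) (simp add: mult_left_mono norm_bop_apply_le)
  then show "norm (bop_apply (A \<circ>\<^sub>B B) x) \<le> norm A * norm B * norm x" by (simp add: mult.assoc)
qed simp

lemma bounded_bilinear_bop_compose: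
  "bounded_bilinear (bop_compose :: ('b::complex_normed_vector, 'c::complex_normed_vector) bop
     \<Rightarrow> ('a::complex_normed_vector, 'b) bop \<Rightarrow> _)"
proof (rule bounded_bilinear.intro)
  show "\<exists>K. \<forall>(A::('b, 'c) bop) (B::('a, 'b) bop). norm (A \<circ>\<^sub>B B) \<le> norm A * norm B * K"
    by (rule exI[of _ 1]) (simp add: norm_bop_compose_le)
qed (auto intro!: bop_eqI simp: bop_apply_linear)

text \<open>Every bounded complex-linear map is the action of a bounded operator.\<close>

lemma bop_makeI:
  assumes "\<And>x y. f (x + y) = f x + f y" "\<And>c x. f (c *\<^sub>C x) = c *\<^sub>C f x"
    and "\<And>x. norm (f x) \<le> K * norm x"
  obtains F where "bop_apply F = f"
proof -
  have "f (r *\<^sub>R x) = r *\<^sub>R f x" for r x using assms(2) by (simp add: scaleR_scaleC)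
  then have "bounded_clinear f"
    using assms unfolding bounded_clinear_def
    by (auto intro!: bounded_linear_intro[where K = K] simp: mult.commute)
  then show ?thesis using that Bop_inverse by blast
qed


section \<open>Inverses and spectrum of bounded operators\<close>

lemma graph_inject: "graph A = graph B \<longleftrightarrow> A = B"
proof
  assume g: "graph A = graph B"
  show "A = B"
  proof (rule bop_eqI)
    fix x
    have "(x, bop_apply A x) \<in> graph B" unfolding g[symmetric] by (auto simp: graph_def)
    then show "bop_apply A x = bop_apply B x" by (auto simp: graph_def)
  qed
qed simp

lemma the_bop_graph [simp]: "the_bop (graph A) = A"
  unfolding the_bop_def by (rule the_equality) (auto simp: graph_inject)

lemma bop_compose_eq_idD:
  "R \<circ>\<^sub>B M = bop_id \<Longrightarrow> bop_apply R (bop_apply M x) = x"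
  by (drule arg_cong[where f = "\<lambda>B. bop_apply B x"]) simp

lemma graph_eq_converse_iff:
  fixes M R :: "('a::complex_normed_vector, 'a) bop"
  shows
  "graph R = (graph M)\<inverse> \<longleftrightarrow> R \<circ>\<^sub>B M = bop_id \<and> M \<circ>\<^sub>B R = bop_id"
proof
  assume g: "graph R = (graph M)\<inverse>"
  have 1: "bop_apply R (bop_apply M x) = x" for x
  proof -
    have "(bop_apply M x, x) \<in> graph R" unfolding g by (auto simp: graph_def)
    then show ?thesis by (auto simp: graph_def)
  qed
  have 2: "bop_apply M (bop_apply R x) = x" for x
  proof -
    have "(x, bop_apply R x) \<in> graph R" by (auto simp: graph_def)
    then have "(bop_apply R x, x) \<in> graph M" unfolding g by simp
    then show ?thesis by (auto simp: graph_def)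
  qed
  show "R \<circ>\<^sub>B M = bop_id \<and> M \<circ>\<^sub>B R = bop_id" using 1 2 by (auto intro!: bop_eqI)
next
  assume "R \<circ>\<^sub>B M = bop_id \<and> M \<circ>\<^sub>B R = bop_id"
  then have "bop_apply R (bop_apply M x) = x" "bop_apply M (bop_apply R x) = x" for x
    by (auto intro: bop_compose_eq_idD)
  then show "graph R = (graph M)\<inverse>" by (auto simp: graph_def)
qed

lemma op_shift_graph: "op_shift (graph A) z = graph (A - z *\<^sub>C bop_id)"
  by (auto simp: op_shift_def graph_def)

lemma not_in_spectrum_iff:
  "z \<notin> spectrum A \<longleftrightarrow> (\<exists>R. R \<circ>\<^sub>B (A - z *\<^sub>C bop_id) = bop_id \<and> (A - z *\<^sub>C bop_id) \<circ>\<^sub>B R = bop_id)"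
  by (simp add: op_spectrum_def op_shift_graph graph_eq_converse_iff)

lemma bop_inverse_eqI:
  assumes "R \<circ>\<^sub>B M = bop_id" "M \<circ>\<^sub>B R = bop_id"
  shows "bop_inverse M = R"
proof -
  have "graph R = (graph M)\<inverse>" using assms by (simp add: graph_eq_converse_iff)
  then show ?thesis unfolding bop_inverse_def by (metis the_bop_graph)
qed

text \<open>
  If \<open>M\<close> is invertible with \<open>\<parallel>M\<^sup>-\<^sup>1\<parallel> \<le> 1 / m\<close>, then \<open>M + X\<close> is invertible for \<open>\<parallel>X\<parallel> < m\<close>. Instead of summing
  the Neumann series, \<open>(M + X) x = y\<close> is solved for each \<open>y\<close> by a contraction argument.
\<close>

lemma invertible_perturbation:
  fixes M :: "('a::{complex_normed_vector, banach}, 'a) bop"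
  assumes RM: "R \<circ>\<^sub>B M = bop_id" "M \<circ>\<^sub>B R = bop_id"
    and low: "\<And>x. m * norm x \<le> norm (bop_apply M x)" and X: "norm X < m"
  obtains S where "S \<circ>\<^sub>B (M + X) = bop_id" "(M + X) \<circ>\<^sub>B S = bop_id" "norm S \<le> 1 / (m - norm X)"
proof -
  have m: "m > 0" using X norm_ge_zero[of X] by linarith
  have R1: "bop_apply R (bop_apply M x) = x" and R2: "bop_apply M (bop_apply R x) = x" for x
    using RM by (auto intro: bop_compose_eq_idD)
  have Rn: "norm (bop_apply R y) \<le> norm y / m" for y
    using low[of "bop_apply R y"] m by (simp add: R2 field_simps)
  have low': "(m - norm X) * norm x \<le> norm (bop_apply (M + X) x)" for x
  proof -
    have "norm (bop_apply M x) \<le> norm (bop_apply (M + X) x) + norm (bop_apply X x)"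
      using norm_triangle_ineq4[of "bop_apply (M + X) x" "bop_apply X x"] by simp
    with low[of x] norm_bop_apply_le[of X x] show ?thesis by (simp add: algebra_simps)
  qed
  have ex: "\<exists>x. bop_apply (M + X) x = y" for y
  proof -
    \<comment> \<open>The equation \<open>(M + X) x = y\<close> in fixed point form.\<close>
    define h where "h x = bop_apply R (y - bop_apply X x)" for x
    have "\<exists>!x. x \<in> UNIV \<and> h x = x"
    proof (rule Banach_fix)
      show "dist (h u) (h v) \<le> (norm X / m) * dist u v" for u v
      proof -
        have "h u - h v = bop_apply R (bop_apply X (v - u))"
          by (simp add: h_def bop_apply_linear)
        then have "norm (h u - h v) \<le> norm (bop_apply X (v - u)) / m" using Rn by simp
        also have "\<dots> \<le> (norm X * norm (v - u)) / m"
          using norm_bop_apply_le m by (intro divide_right_mono) auto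
        finally show ?thesis by (simp add: dist_norm norm_minus_commute)
      qed
      show "norm X / m < 1" "0 \<le> norm X / m" using X m by auto
      show "complete (UNIV::'a set)" by (simp add: complete_UNIV)
    qed auto
    then obtain x where "h x = x" by auto
    then have "bop_apply M (h x) = bop_apply M x" by simp
    then have "y - bop_apply X x = bop_apply M x" by (simp add: h_def R2)
    then show ?thesis by (intro exI[of _ x]) (simp add: algebra_simps)
  qed
  define s where "s y = (SOME x. bop_apply (M + X) x = y)" for y
  have s: "bop_apply (M + X) (s y) = y" for y unfolding s_def using someI_ex[OF ex[of y]] .
  have inj: "u = v" if "bop_apply (M + X) u = bop_apply (M + X) v" for u v
  proof -
    have "(m - norm X) * norm (u - v) \<le> 0"
      using low'[of "u - v"] that unfolding bop_apply_linear by simp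
    with X show ?thesis by (simp add: mult_le_0_iff)
  qed
  have sn: "norm (s y) \<le> 1 / (m - norm X) * norm y" for y
    using low'[of "s y"] X unfolding s by (simp add: field_simps)
  obtain S where S: "bop_apply S = s"
  proof (rule bop_makeI)
    show "s (x + y) = s x + s y" for x y by (rule inj) (simp only: s bop_apply_linear)
    show "s (c *\<^sub>C x) = c *\<^sub>C s x" for c x by (rule inj) (simp only: s bop_apply_scaleC)
    show "norm (s y) \<le> 1 / (m - norm X) * norm y" for y by (rule sn)
  qed
  show ?thesis
  proof
    show "(M + X) \<circ>\<^sub>B S = bop_id" by (rule bop_eqI) (use s S in simp)
    show "S \<circ>\<^sub>B (M + X) = bop_id"
    proof (rule bop_eqI)
      fix x
      show "bop_apply (S \<circ>\<^sub>B (M + X)) x = bop_apply bop_id x"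
        by (rule inj) (use s S in simp)
    qed
    show "norm S \<le> 1 / (m - norm X)" using sn X by (intro norm_bop_le) (auto simp: S)
  qed
qed

lemma spectrum_norm_le:
  fixes A :: "('a::{complex_normed_vector, banach}, 'a) bop"
  assumes "z \<in> spectrum A"
  shows "cmod z \<le> norm A"
proof (rule ccontr)
  assume "\<not> cmod z \<le> norm A"
  then have lt: "norm A < cmod z" by simp
  then have "z \<noteq> 0" using norm_ge_zero[of A] by auto
  then have "((- inverse z) *\<^sub>C bop_id) \<circ>\<^sub>B ((- z) *\<^sub>C bop_id) = (bop_id :: ('a, 'a) bop)"
    and "((- z) *\<^sub>C bop_id) \<circ>\<^sub>B ((- inverse z) *\<^sub>C bop_id) = (bop_id :: ('a, 'a) bop)"
    by (auto intro!: bop_eqI simp: scaleC_scaleC scaleC_one)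
  from invertible_perturbation[OF this, of "cmod z" A] lt obtain S
    where "S \<circ>\<^sub>B ((- z) *\<^sub>C bop_id + A) = bop_id" "((- z) *\<^sub>C bop_id + A) \<circ>\<^sub>B S = bop_id"
    by (auto simp: norm_scaleC)
  moreover have "(- z) *\<^sub>C bop_id + A = A - z *\<^sub>C bop_id"
    by (simp add: scaleC_minus_left)
  ultimately have "z \<notin> spectrum A" unfolding not_in_spectrum_iff by auto
  with assms show False by simp
qed


section \<open>Adjoints in a Hilbert space\<close>

lemma cinner_linear:
  "cinner x (y - z) = cinner x y - cinner x (z::'a::complex_hilbert_space)"
  "cinner (x - y) z = cinner x z - cinner y (z::'a::complex_hilbert_space)"
  "cinner x (r *\<^sub>R z) = r * cinner x (z::'a::complex_hilbert_space)"
  "cinner (r *\<^sub>R x) z = r * cinner x (z::'a::complex_hilbert_space)"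
  "cinner x 0 = 0" "cinner 0 x = 0"
proof -
  show *: "cinner x (r *\<^sub>R z) = r * cinner x z" for r and x z :: 'a
    by (simp add: scaleR_scaleC cinner_scaleC_right)
  show **: "cinner (r *\<^sub>R x) z = r * cinner x z" for r and x z :: 'a
    by (simp add: scaleR_scaleC cinner_scaleC_left)
  show "cinner x (y - z) = cinner x y - cinner x z"
    using cinner_add_right[of x y "(-1) *\<^sub>R z"] *[of x "-1" z] by simp
  show "cinner (x - y) z = cinner x z - cinner y z"
    using cinner_add_left[of x "(-1) *\<^sub>R y" z] **[of "-1" y z] by simp
  show "cinner x 0 = 0" using *[of x 0 0] by simp
  show "cinner 0 x = 0" using **[of 0 0 x] by simp
qed

lemma Re_cinner_self: "Re (cinner x x) = (norm x)\<^sup>2"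
  by (simp add: cinner_self)

lemma Re_cinner_commute: "Re (cinner x y) = Re (cinner y x)"
  by (subst cinner_commute) simp

lemma norm_add_sq:
  "(norm (x + y))\<^sup>2 = (norm x)\<^sup>2 + 2 * Re (cinner x y) + (norm (y::'a::complex_hilbert_space))\<^sup>2"
  unfolding Re_cinner_self[symmetric]
  by (simp add: cinner_add_left cinner_add_right Re_cinner_commute[of y x])

lemma norm_diff_sq:
  "(norm (x - y))\<^sup>2 = (norm x)\<^sup>2 - 2 * Re (cinner x y) + (norm (y::'a::complex_hilbert_space))\<^sup>2"
  unfolding Re_cinner_self[symmetric]
  by (simp add: cinner_linear Re_cinner_commute[of y x])

lemma cinner_eqI:
  assumes "\<And>x. cinner y x = cinner z (x::'a::complex_hilbert_space)"
  shows "y = z"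
proof -
  have "cinner (y - z) (y - z) = 0" using assms by (simp add: cinner_linear)
  then show ?thesis by (simp add: cinner_self)
qed

lemma Re_cinner_le: "\<bar>Re (cinner x y)\<bar> \<le> norm x * norm (y::'a::complex_hilbert_space)"
proof (cases "x = 0 \<or> y = 0")
  case False
  define a b where "a = norm x" and "b = norm y"
  have ab: "a > 0" "b > 0" using False by (auto simp: a_def b_def)
  have "0 \<le> (norm (b *\<^sub>R x - a *\<^sub>R y))\<^sup>2" "0 \<le> (norm (b *\<^sub>R x + a *\<^sub>R y))\<^sup>2" by simp_all
  then have "0 \<le> 2 * (a * b) * (a * b - Re (cinner x y))" "0 \<le> 2 * (a * b) * (a * b + Re (cinner x y))"
    unfolding norm_diff_sq norm_add_sq
    by (simp_all add: cinner_linear a_def[symmetric] b_def[symmetric] power2_eq_square algebra_simps)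
  then have "0 \<le> a * b - Re (cinner x y)" "0 \<le> a * b + Re (cinner x y)"
    using zero_le_mult_iff[of "2 * (a * b)"] mult_pos_pos[OF ab] by auto
  then show ?thesis by (simp add: a_def b_def abs_le_iff)
qed (auto simp: cinner_linear)

text \<open>
  The Riesz representation theorem. The representing vector minimises
  \<open>\<parallel>x\<parallel>\<^sup>2 - 2 Re (f x)\<close>; minimising sequences are Cauchy by the parallelogram law.
\<close>

lemma riesz_representation:
  fixes f :: "'a::complex_hilbert_space \<Rightarrow> complex"
  assumes add: "\<And>x y. f (x + y) = f x + f y" and scale: "\<And>c x. f (c *\<^sub>C x) = c * f x"
    and bd: "\<And>x. cmod (f x) \<le> K * norm x"
  obtains z where "\<And>x. f x = cinner z x"
proof -
  have scaleR: "f (r *\<^sub>R x) = r * f x" for r x using scale by (simp add: scaleR_scaleC)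
  have "bounded_linear f"
    using add scaleR bd
    by (intro bounded_linear_intro[where K = K]) (auto simp: mult.commute scaleR_conv_of_real)
  note contf = bounded_linear.tendsto[OF this]
  define J where "J x = (norm x)\<^sup>2 - 2 * Re (f x)" for x
  have lower: "- (K\<^sup>2) \<le> J x" for x
  proof -
    have "Re (f x) \<le> K * norm x" using bd[of x] complex_Re_le_cmod order_trans by blast
    moreover have "0 \<le> (norm x - K)\<^sup>2" by simp
    ultimately show ?thesis by (simp add: J_def power2_diff algebra_simps)
  qed
  then have bdd: "bdd_below (range J)" by (auto simp: bdd_below_def)
  define m where "m = Inf (range J)"
  have m: "m \<le> J x" for x unfolding m_def using bdd by (auto intro: cInf_lower)
  have "\<exists>x. J x < m + 1 / real (Suc n)" for n
  proof -
    have "m < m + 1 / real (Suc n)" by simp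
    then show ?thesis using cInf_lessD[of "range J"] unfolding m_def by fastforce
  qed
  then obtain X where X: "\<And>n. J (X n) < m + 1 / real (Suc n)" by metis
  have par: "(norm (x - y))\<^sup>2 \<le> 2 * (J x - m) + 2 * (J y - m)" for x y
  proof -
    have "4 * m \<le> 4 * J ((1/2) *\<^sub>R (x + y))" using m by simp
    also have "\<dots> = (norm (x + y))\<^sup>2 - 4 * Re (f x) - 4 * Re (f y)"
      unfolding J_def scaleR norm_scaleR by (simp add: add power2_eq_square algebra_simps)
    finally show ?thesis unfolding norm_add_sq norm_diff_sq J_def by simp
  qed
  have "Cauchy X"
  proof (rule CauchyI)
    fix e :: real assume e: "e > 0"
    then obtain N where N: "4 / e\<^sup>2 < real (Suc N)"
      using reals_Archimedean2[of "4 / e\<^sup>2"] by (metis less_Suc_eq of_nat_less_iff order_less_trans)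
    have b: "J (X n) - m < e\<^sup>2 / 4" if "n \<ge> N" for n
    proof -
      have "1 / real (Suc n) \<le> 1 / real (Suc N)" using that by (simp add: frac_le)
      also have "\<dots> < e\<^sup>2 / 4" using N e by (simp add: field_simps)
      finally show ?thesis using X[of n] by simp
    qed
    show "\<exists>M. \<forall>i\<ge>M. \<forall>n\<ge>M. norm (X i - X n) < e"
    proof (intro exI allI impI)
      fix i n assume "N \<le> i" "N \<le> n"
      then have "(norm (X i - X n))\<^sup>2 < e\<^sup>2" using par[of "X i" "X n"] b[of i] b[of n] by simp
      then show "norm (X i - X n) < e" using e by (simp add: power_less_imp_less_base)
    qed
  qed
  then obtain z where z: "X \<longlonglongrightarrow> z" using Cauchy_convergent convergent_def by blast
  have "(\<lambda>n. J (X n)) \<longlonglongrightarrow> J z" unfolding J_def by (intro tendsto_intros z contf)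
  moreover have "(\<lambda>n. m + 1 / real (Suc n)) \<longlonglongrightarrow> m + 0"
    by (intro tendsto_intros LIMSEQ_Suc[OF lim_1_over_n])
  ultimately have Jz: "J z \<le> m" using X by (intro LIMSEQ_le[of _ "J z" _ m]) (auto intro: less_imp_le)
  have Re: "Re (f x) = Re (cinner z x)" for x
  proof -
    define q where "q = Re (cinner z x) - Re (f x)"
    have quad: "0 \<le> t\<^sup>2 * (norm x)\<^sup>2 + 2 * t * q" for t
      using Jz m[of "z + t *\<^sub>R x"]
      unfolding J_def norm_add_sq q_def
      by (simp add: add scaleR cinner_linear power_mult_distrib algebra_simps)
    have "q = 0"
    proof (rule ccontr)
      assume q: "q \<noteq> 0"
      \<comment> \<open>The summand \<open>1\<close> makes \<open>N\<close> positive also for \<open>x = 0\<close>.\<close>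
      define N where "N = (norm x)\<^sup>2 + 1"
      have N: "N > 0" by (simp add: N_def add_nonneg_pos)
      have "0 \<le> (q / N)\<^sup>2 * (norm x)\<^sup>2 - 2 * q\<^sup>2 / N"
        using quad[of "- q / N"] by (simp add: power2_eq_square)
      also have "\<dots> \<le> (q / N)\<^sup>2 * N - 2 * q\<^sup>2 / N"
        by (intro diff_mono mult_left_mono) (auto simp: N_def)
      also have "\<dots> = - (q\<^sup>2 / N)" using N by (simp add: power2_eq_square field_simps)
      also have "\<dots> < 0" using q N by simp
      finally show False by simp
    qed
    then show ?thesis by (simp add: q_def)
  qed
  have "f x = cinner z x" for x
    using Re[of x] Re[of "\<i> *\<^sub>C x"] by (simp add: complex_eq_iff scale cinner_scaleC_right)
  then show ?thesis by (rule that)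
qed

text \<open>The factor 2 keeps the proof short; only boundedness of the form is needed.\<close>

lemma cinner_le: "cmod (cinner x y) \<le> 2 * norm x * norm (y::'a::complex_hilbert_space)"
proof -
  have "Im (cinner x y) = - Re (cinner x (\<i> *\<^sub>C y))" by (simp add: cinner_scaleC_right)
  then have "\<bar>Im (cinner x y)\<bar> \<le> norm x * norm y"
    using Re_cinner_le[of x "\<i> *\<^sub>C y"] by (simp add: norm_scaleC)
  then show ?thesis using Re_cinner_le[of x y] cmod_le[of "cinner x y"] by simp
qed

lemma adjoint_vector_norm_le:
  fixes A :: "('a::complex_hilbert_space, 'b::complex_hilbert_space) bop"
  assumes z: "\<And>x. cinner z x = cinner y (bop_apply A x)"
  shows "norm z \<le> norm A * norm y"
proof (cases "z = 0")
  case False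
  have "(norm z)\<^sup>2 = Re (cinner y (bop_apply A z))" by (simp flip: Re_cinner_self add: z)
  also have "\<dots> \<le> norm y * norm (bop_apply A z)" by (rule order_trans[OF abs_ge_self Re_cinner_le])
  also have "\<dots> \<le> norm y * (norm A * norm z)" by (intro mult_left_mono norm_bop_apply_le) auto
  finally show ?thesis using False by (simp add: power2_eq_square mult.commute mult.left_commute)
qed simp

text \<open>
  By the Riesz representation theorem \<^term>\<open>op_adjoint (graph A)\<close> is the graph of a bounded operator,
  so \<^const>\<open>adj\<close> is the Hilbert space adjoint of every bounded operator.
\<close>

lemma cinner_adj:
  fixes A :: "('a::complex_hilbert_space, 'b::complex_hilbert_space) bop"
  shows "cinner (bop_apply (adj A) y) x = cinner y (bop_apply A x)"
proof -
  have "\<exists>z. \<forall>x. cinner z x = cinner y (bop_apply A x)" for y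
  proof -
    obtain z where "\<And>x. cinner y (bop_apply A x) = cinner z x"
    proof (rule riesz_representation)
      show "cmod (cinner y (bop_apply A x)) \<le> (2 * norm y * norm A) * norm x" for x
      proof -
        have "cmod (cinner y (bop_apply A x)) \<le> 2 * norm y * norm (bop_apply A x)" by (rule cinner_le)
        also have "\<dots> \<le> 2 * norm y * (norm A * norm x)"
          by (intro mult_left_mono norm_bop_apply_le) auto
        finally show ?thesis by (simp add: mult.assoc)
      qed
    qed (auto simp: bop_apply_linear bop_apply_scaleC cinner_add_right cinner_scaleC_right)
    then show ?thesis by metis
  qed
  then obtain s where s: "\<And>y x. cinner (s y) x = cinner y (bop_apply A x)" by metis
  obtain S where S: "bop_apply S = s"
  proof (rule bop_makeI)
    show "s (x + y) = s x + s y" for x y by (rule cinner_eqI) (simp add: s cinner_add_left)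
    show "s (c *\<^sub>C x) = c *\<^sub>C s x" for c x by (rule cinner_eqI) (simp add: s cinner_scaleC_left)
    show "norm (s y) \<le> norm A * norm y" for y by (rule adjoint_vector_norm_le) (rule s)
  qed
  have "z = s y" if "\<And>x. cinner y (bop_apply A x) = cinner z x" for y z
    by (rule cinner_eqI) (simp add: s that)
  then have "op_adjoint (graph A) = graph S"
    by (auto simp: op_adjoint_def graph_def S s)
  then show ?thesis by (simp add: adj_def S s)
qed

lemma adj_diff: "adj A - adj B = adj (A - B)"
  by (rule bop_eqI, rule cinner_eqI) (simp add: cinner_adj cinner_linear)

lemma norm_adj_le: "norm (adj A) \<le> norm A"
  by (rule norm_bop_le) (auto intro: adjoint_vector_norm_le cinner_adj)

lemma continuous_on_adj: "continuous_on S adj"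
proof (rule continuous_onI)
  fix x :: "('a, 'b) bop" and e :: real assume "e > 0"
  then show "\<exists>d>0. \<forall>x'\<in>S. dist x' x < d \<longrightarrow> dist (adj x') (adj x) \<le> e"
    by (intro exI[of _ e]) (auto simp: dist_norm adj_diff intro: order_trans[OF norm_adj_le])
qed


section \<open>The resolvent of a symmetric bounded operator\<close>

text \<open>
  With \<open>m\<close> the infimum of \<open>\<parallel>(A - a) x\<parallel>\<close> over unit vectors, the operator
  \<open>P = (A - a)\<^sup>2 - m\<^sup>2 = (A - (a + m)) (A - (a - m))\<close> is nonnegative and \<open>\<langle>x, P x\<rangle>\<close> has infimum
  \<open>0\<close> over unit vectors.
  As \<open>\<parallel>P x\<parallel>\<^sup>2 \<le> c \<langle>x, P x\<rangle>\<close>, it is not bounded below, so \<open>a + m\<close> or \<open>a - m\<close> is in the spectrum.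
\<close>

lemma symmetric_lower_bound_real:
  fixes A :: "('a::complex_hilbert_space, 'a) bop" and a d :: real
  assumes sym: "\<And>x y. cinner (bop_apply A x) y = cinner x (bop_apply A y)"
    and sep: "\<And>l::real. complex_of_real l \<in> spectrum A \<Longrightarrow> d \<le> \<bar>a - l\<bar>"
  shows "d * norm x \<le> norm (bop_apply (A - complex_of_real a *\<^sub>C bop_id) x)"
proof (rule ccontr)
  define T where "T = A - complex_of_real a *\<^sub>C bop_id"
  assume neg: "\<not> ?thesis"
  then have x0: "norm (bop_apply T x) < d * norm x" by (simp add: T_def)
  then have "x \<noteq> 0" by (auto simp: bop_apply_linear)
  have symT: "cinner (bop_apply T u) v = cinner u (bop_apply T v)" for u v
    by (simp add: T_def sym cinner_linear cinner_scaleC_left cinner_scaleC_right)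
  define U where "U = {norm (bop_apply T u) | u. norm u = 1}"
  define m where "m = Inf U"
  have bdd: "bdd_below U" by (auto simp: U_def bdd_below_def intro!: exI[of _ 0])
  have scale: "norm (bop_apply T u) / norm u \<in> U" if "u \<noteq> 0" for u
    unfolding U_def using that
    by (auto intro!: exI[of _ "inverse (norm u) *\<^sub>R u"] simp: bop_apply_linear field_simps)
  have ne: "U \<noteq> {}" using scale[OF \<open>x \<noteq> 0\<close>] by auto
  have m0: "m \<ge> 0" unfolding m_def by (rule cInf_greatest[OF ne]) (auto simp: U_def)
  have mle: "m * norm u \<le> norm (bop_apply T u)" for u
  proof (cases "u = 0")
    case False
    then have "m \<le> norm (bop_apply T u) / norm u"
      unfolding m_def by (intro cInf_lower scale bdd)
    then show ?thesis using False by (simp add: field_simps)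
  qed simp
  have "m \<le> norm (bop_apply T x) / norm x"
    unfolding m_def by (intro cInf_lower scale bdd \<open>x \<noteq> 0\<close>)
  also have "\<dots> < d" using x0 \<open>x \<noteq> 0\<close> by (simp add: field_simps)
  finally have md: "m < d" .
  have below: "\<exists>k>0. \<forall>u. k * norm u \<le> norm (bop_apply T u - s *\<^sub>R u)" if "\<bar>s\<bar> = m" for s
  proof -
    have "complex_of_real (a + s) \<notin> spectrum A" using sep[of "a + s"] that md by force
    then obtain R where R: "R \<circ>\<^sub>B (A - complex_of_real (a + s) *\<^sub>C bop_id) = bop_id"
      unfolding not_in_spectrum_iff by blast
    have "bop_apply R (bop_apply T u - s *\<^sub>R u) = u" for u
    proof -
      have "bop_apply T u - s *\<^sub>R u = bop_apply (A - complex_of_real (a + s) *\<^sub>C bop_id) u"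
        by (simp add: T_def scaleR_scaleC scaleC_add_left)
      then show ?thesis using bop_compose_eq_idD[OF R] by simp
    qed
    then have "norm u \<le> norm R * norm (bop_apply T u - s *\<^sub>R u)" for u
      by (metis norm_bop_apply_le)
    then have "norm u \<le> (norm R + 1) * norm (bop_apply T u - s *\<^sub>R u)" for u
      by (rule order_trans) (simp add: mult_right_mono)
    then show ?thesis
      by (intro exI[of _ "1 / (norm R + 1)"])
        (auto simp: add_nonneg_pos pos_divide_le_eq mult.commute)
  qed
  \<comment> \<open>Both factors of \<open>P\<close> are bounded below, as \<open>a \<plusminus> m\<close> is too close to \<open>a\<close> to lie in the spectrum.\<close>
  obtain k1 where k1: "k1 > 0" "\<And>u. k1 * norm u \<le> norm (bop_apply T u - m *\<^sub>R u)"
    using below[of m] m0 by auto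
  obtain k2 where k2: "k2 > 0" "\<And>u. k2 * norm u \<le> norm (bop_apply T u - (- m) *\<^sub>R u)"
    using below[of "- m"] m0 by auto
  define P where "P = T \<circ>\<^sub>B T - (m\<^sup>2) *\<^sub>R bop_id"
  define k where "k = k1 * k2"
  have k: "k > 0" using k1 k2 by (simp add: k_def)
  have Pbelow: "k * norm u \<le> norm (bop_apply P u)" for u
  proof -
    let ?v = "bop_apply T u - (- m) *\<^sub>R u"
    have "k * norm u = k1 * (k2 * norm u)" by (simp add: k_def)
    also have "\<dots> \<le> k1 * norm ?v" using k1 k2 by (intro mult_left_mono) auto
    also have "\<dots> \<le> norm (bop_apply T ?v - m *\<^sub>R ?v)" by (rule k1)
    also have "bop_apply T ?v - m *\<^sub>R ?v = bop_apply P u"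
      by (simp add: P_def bop_apply_linear algebra_simps power2_eq_square)
    finally show ?thesis .
  qed
  define Q where "Q u = Re (cinner u (bop_apply P u))" for u
  have symP: "cinner (bop_apply P u) v = cinner u (bop_apply P v)" for u v
    by (simp add: P_def symT cinner_linear)
  have Q: "Q u = (norm (bop_apply T u))\<^sup>2 - m\<^sup>2 * (norm u)\<^sup>2" for u
    by (simp add: Q_def P_def cinner_linear symT[symmetric] cinner_self power2_eq_square)
  have Q0: "0 \<le> Q u" for u
    using power_mono[OF mle[of u], of 2] m0 by (simp add: Q power_mult_distrib)
  define c where "c = norm P + 1"
  have c: "c > 0" by (simp add: c_def add_nonneg_pos)
  have PQ: "(norm (bop_apply P u))\<^sup>2 \<le> c * Q u" for u
  proof -
    define w where "w = bop_apply P u"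
    have "Q w \<le> norm w * norm (bop_apply P w)" unfolding Q_def
      by (rule order_trans[OF abs_ge_self Re_cinner_le])
    also have "\<dots> \<le> norm w * (c * norm w)"
      using norm_bop_apply_le[of P w]
      by (intro mult_left_mono) (auto simp: c_def algebra_simps intro: order_trans)
    finally have Qw: "Q w \<le> c * (norm w)\<^sup>2" by (simp add: power2_eq_square mult.left_commute)
    have "cinner u (bop_apply P w) = cinner w w" by (simp add: symP[symmetric] w_def)
    \<comment> \<open>Positivity of the form \<open>Q\<close> at the point where \<open>t \<mapsto> Q (u - t w)\<close> is estimated best.\<close>
    then have "Q (u - (1 / c) *\<^sub>R w) = Q u - 2 / c * (norm w)\<^sup>2 + Q w / c\<^sup>2"
      unfolding Q_def
      by (simp add: bop_apply_linear cinner_linear w_def[symmetric] cinner_self power2_eq_square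
          add_divide_distrib diff_divide_distrib)
    also have "\<dots> \<le> Q u - 2 / c * (norm w)\<^sup>2 + c * (norm w)\<^sup>2 / c\<^sup>2"
      using Qw by (intro add_left_mono divide_right_mono) auto
    also have "\<dots> = Q u - (norm w)\<^sup>2 / c" using c by (simp add: power2_eq_square field_simps)
    finally have "0 \<le> Q u - (norm w)\<^sup>2 / c" using Q0[of "u - (1 / c) *\<^sub>R w"] by linarith
    then show ?thesis using c by (simp add: w_def field_simps)
  qed
  have "m < sqrt (m\<^sup>2 + k\<^sup>2 / c)"
    using k c by (intro real_less_rsqrt) auto
  then obtain v where v: "norm v = 1" "norm (bop_apply T v) < sqrt (m\<^sup>2 + k\<^sup>2 / c)"
    using cInf_lessD[OF ne, of "sqrt (m\<^sup>2 + k\<^sup>2 / c)", folded m_def] unfolding U_def by auto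
  have "(norm (bop_apply T v))\<^sup>2 < (sqrt (m\<^sup>2 + k\<^sup>2 / c))\<^sup>2"
    using v(2) by (intro power_strict_mono) auto
  then have "(norm (bop_apply T v))\<^sup>2 < m\<^sup>2 + k\<^sup>2 / c" using c by simp
  then have "c * Q v < k\<^sup>2" using c v(1) by (simp add: Q field_simps)
  moreover have "k\<^sup>2 \<le> (norm (bop_apply P v))\<^sup>2"
    using Pbelow[of v] k v(1) by (intro power_mono) auto
  ultimately show False using PQ[of v] by simp
qed

text \<open>
  The resolvent bound \<open>\<parallel>(A - z)\<^sup>-\<^sup>1\<parallel> \<le> 1 / dist(z, \<sigma>(A))\<close>, as a lower bound for \<open>A - z\<close>. For \<open>z = a + i b\<close>,
  \<open>\<parallel>(A - z) x\<parallel>\<^sup>2 = \<parallel>(A - a) x\<parallel>\<^sup>2 + b\<^sup>2 \<parallel>x\<parallel>\<^sup>2\<close>, which reduces the claim to real points.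
\<close>

lemma symmetric_lower_bound:
  fixes A :: "('a::complex_hilbert_space, 'a) bop"
  assumes sym: "\<And>x y. cinner (bop_apply A x) y = cinner x (bop_apply A y)"
    and real: "spectrum A \<subseteq> range complex_of_real"
    and sep: "\<And>l. l \<in> spectrum A \<Longrightarrow> d \<le> cmod (z - l)"
  shows "d * norm x \<le> norm (bop_apply (A - z *\<^sub>C bop_id) x)"
proof -
  define a b where "a = Re z" and "b = Im z"
  define y where "y = bop_apply (A - complex_of_real a *\<^sub>C bop_id) x"
  have symy: "cinner y x = cinner x y"
    by (simp add: y_def sym cinner_linear cinner_scaleC_left cinner_scaleC_right)
  then have "Im (cinner y x) = 0"
    using cinner_commute[of x y] by (simp add: complex_eq_iff)
  have z: "z = complex_of_real a + \<i> * complex_of_real b" by (simp add: a_def b_def complex_eq_iff)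
  have "bop_apply (A - z *\<^sub>C bop_id) x = y - (\<i> * complex_of_real b) *\<^sub>C x"
    by (simp add: y_def z scaleC_add_left)
  then have n: "(norm (bop_apply (A - z *\<^sub>C bop_id) x))\<^sup>2 = (norm y)\<^sup>2 + b\<^sup>2 * (norm x)\<^sup>2"
    using \<open>Im (cinner y x) = 0\<close>
    by (simp add: norm_diff_sq cinner_scaleC_right norm_scaleC norm_mult power_mult_distrib)
  \<comment> \<open>A real point of the spectrum at distance \<open>d\<close> from \<open>z\<close> has distance at least \<open>q\<close> from \<open>Re z\<close>.\<close>
  define q where "q = (if d\<^sup>2 \<le> b\<^sup>2 then 0 else sqrt (d\<^sup>2 - b\<^sup>2))"
  show ?thesis
  proof (cases "d \<ge> 0")
    case True
    have "q * norm x \<le> norm y"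
      unfolding y_def
    proof (rule symmetric_lower_bound_real[OF sym])
      fix l assume "complex_of_real l \<in> spectrum A"
      then have "d \<le> cmod (z - complex_of_real l)" by (rule sep)
      then have "d\<^sup>2 \<le> (cmod (z - complex_of_real l))\<^sup>2" using True by (rule power_mono)
      also have "\<dots> = (a - l)\<^sup>2 + b\<^sup>2" by (simp add: cmod_power2 a_def b_def)
      finally show "q \<le> \<bar>a - l\<bar>" unfolding q_def by (auto intro!: real_le_lsqrt)
    qed
    then have "(q * norm x)\<^sup>2 \<le> (norm y)\<^sup>2" by (intro power_mono) (auto simp: q_def)
    moreover have "d\<^sup>2 \<le> q\<^sup>2 + b\<^sup>2" by (auto simp: q_def)
    then have "d\<^sup>2 * (norm x)\<^sup>2 \<le> (q\<^sup>2 + b\<^sup>2) * (norm x)\<^sup>2" by (rule mult_right_mono) simp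
    ultimately have "(d * norm x)\<^sup>2 \<le> (norm (bop_apply (A - z *\<^sub>C bop_id) x))\<^sup>2"
      unfolding n by (simp add: power_mult_distrib algebra_simps)
    then show ?thesis by (rule power2_le_imp_le) simp
  next
    case False
    then have "d * norm x \<le> 0" by (simp add: mult_nonpos_nonneg)
    then show ?thesis using norm_ge_zero order_trans by blast
  qed
qed


section \<open>Line integrals along curves parametrised by arc length\<close>

text \<open>
  A chord of an arc length parametrised curve is no longer than its parameter interval \<open>[u, v]\<close>:
  adjoining \<open>[u, v]\<close> to a division of \<open>[0, u]\<close> gives a division of \<open>[0, v]\<close>.
\<close>

lemma arc_length_lipschitz:
  assumes len: "\<And>t. t \<ge> 0 \<Longrightarrow> curve_length \<gamma> 0 t = ennreal t"
  shows "1-lipschitz_on {0..} \<gamma>"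
proof -
  have main: "cmod (\<gamma> v - \<gamma> u) \<le> v - u" if uv: "0 \<le> u" "u < v" for u v
  proof -
    define c where "c = cmod (\<gamma> v - \<gamma> u)"
    have step: "(\<Sum>k\<in>d. cmod (\<gamma> (Sup k) - \<gamma> (Inf k))) + c \<le> v" if d: "d division_of {0..u}" for d
    proof -
      have fin: "finite d" using d by auto
      have new: "{u..v} \<notin> d" using division_ofD(2)[OF d] uv by fastforce
      have "(d \<union> {{u..v}}) division_of {0..u} \<union> {u..v}"
      proof (rule division_disjoint_union[OF d])
        show "{{u..v}} division_of {u..v}" using uv by (intro division_of_self[of u v, simplified]) auto
        show "interior {0..u} \<inter> interior {u..v} = {}" by auto
      qed
      moreover have "{0..u} \<union> {u..v} = {0..v}" using uv by auto
      ultimately have "(d \<union> {{u..v}}) division_of {0..v}" by simp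
      then have "(\<Sum>k\<in>d \<union> {{u..v}}. ennreal (cmod (\<gamma> (Sup k) - \<gamma> (Inf k)))) \<le> curve_length \<gamma> 0 v"
        unfolding curve_length_def by (intro SUP_upper) simp
      also have "\<dots> = ennreal v" using len uv by simp
      also have "(\<Sum>k\<in>d \<union> {{u..v}}. ennreal (cmod (\<gamma> (Sup k) - \<gamma> (Inf k))))
          = ennreal ((\<Sum>k\<in>d. cmod (\<gamma> (Sup k) - \<gamma> (Inf k))) + c)"
        using fin new uv by (simp add: c_def sum_ennreal add.commute sum_nonneg flip: ennreal_plus)
      finally show ?thesis using uv by (simp add: ennreal_le_iff)
    qed
    have "{{0..u}} division_of {0..u}" using uv by (intro division_of_self[of 0 u, simplified]) auto
    from step[OF this] have cv: "c \<le> v" by (rule order_trans[rotated]) simp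
    have "ennreal u = curve_length \<gamma> 0 u" using len uv by simp
    also have "\<dots> \<le> ennreal (v - c)"
      unfolding curve_length_def
    proof (rule SUP_least)
      fix d assume "d \<in> {d. d division_of {0..u}}"
      then show "(\<Sum>k\<in>d. ennreal (cmod (\<gamma> (Sup k) - \<gamma> (Inf k)))) \<le> ennreal (v - c)"
        using step[of d] by (simp add: sum_ennreal ennreal_leI)
    qed
    finally have "u \<le> v - c" using cv by (simp add: ennreal_le_iff)
    then show ?thesis by (simp add: c_def)
  qed
  show ?thesis
  proof (rule lipschitz_onI)
    fix x y :: real assume "x \<in> {0..}" "y \<in> {0..}"
    then show "dist (\<gamma> x) (\<gamma> y) \<le> 1 * dist x y"
      using main[of x y] main[of y x]
      by (cases x y rule: linorder_cases) (auto simp: dist_norm norm_minus_commute)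
  qed simp
qed

text \<open>
  The forward difference quotients of \<open>\<gamma>\<close>. They are continuous and bounded by the Lipschitz constant
  of \<open>\<gamma>\<close>, and their integrals converge to the increments of \<open>\<gamma>\<close>, so they replace the derivative
  of \<open>\<gamma>\<close>, which need not exist everywhere.
\<close>

definition diff_quot :: "(real \<Rightarrow> complex) \<Rightarrow> nat \<Rightarrow> real \<Rightarrow> complex" where
  "diff_quot \<gamma> n t = real (Suc n) *\<^sub>R (\<gamma> (t + 1 / real (Suc n)) - \<gamma> t)"

lemma continuous_on_diff_quot:
  assumes "1-lipschitz_on {0..} \<gamma>" "0 \<le> a"
  shows "continuous_on {a..b} (diff_quot \<gamma> n)"
proof -
  have c: "continuous_on {0..} \<gamma>" by (rule lipschitz_on_continuous_on[OF assms(1)])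
  show ?thesis
    unfolding diff_quot_def
    by (intro continuous_intros continuous_on_compose2[OF c] continuous_on_subset[OF c])
      (use assms(2) in auto)
qed

lemma norm_diff_quot_le:
  assumes "1-lipschitz_on {0..} \<gamma>" "0 \<le> t"
  shows "cmod (diff_quot \<gamma> n t) \<le> 1"
proof -
  have "dist (\<gamma> (t + 1 / real (Suc n))) (\<gamma> t) \<le> 1 * dist (t + 1 / real (Suc n)) t"
    using assms(2) by (intro lipschitz_onD[OF assms(1)]) auto
  then have "real (Suc n) * cmod (\<gamma> (t + 1 / real (Suc n)) - \<gamma> t) \<le> real (Suc n) * (1 / real (Suc n))"
    by (intro mult_left_mono) (auto simp: dist_norm)
  then show ?thesis by (simp add: diff_quot_def)
qed

lemma average_tendsto:
  assumes L: "1-lipschitz_on {0..} (\<gamma> :: real \<Rightarrow> complex)" and w: "0 \<le> w"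
  shows "(\<lambda>n. real (Suc n) *\<^sub>R integral {w..w + 1 / real (Suc n)} \<gamma>) \<longlonglongrightarrow> \<gamma> w"
proof (rule Lim_transform_bound[where f = "\<lambda>n. _ n - \<gamma> w" and g = "\<lambda>n. 1 / real (Suc n)",
      THEN LIM_zero_cancel])
  have c: "continuous_on {w..b} \<gamma>" for b
    by (rule continuous_on_subset[OF lipschitz_on_continuous_on[OF L]]) (use w in auto)
  have "norm (real (Suc n) *\<^sub>R integral {w..w + 1 / real (Suc n)} \<gamma> - \<gamma> w) \<le> 1 / real (Suc n)" for n
  proof -
    define h where "h = 1 / real (Suc n)"
    have h: "h > 0" "real (Suc n) * h = 1" by (auto simp: h_def)
    have "integral {w..w + h} (\<lambda>s. \<gamma> s - \<gamma> w) = integral {w..w + h} \<gamma> - h *\<^sub>R \<gamma> w"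
      using h by (subst integral_diff) (auto simp: integrable_continuous_real c scaleR_conv_of_real)
    then have "real (Suc n) *\<^sub>R integral {w..w + h} (\<lambda>s. \<gamma> s - \<gamma> w)
        = real (Suc n) *\<^sub>R integral {w..w + h} \<gamma> - (real (Suc n) * h) *\<^sub>R \<gamma> w"
      by (simp only: scaleR_right_diff_distrib scaleR_scaleR)
    moreover have "norm (integral {w..w + h} (\<lambda>s. \<gamma> s - \<gamma> w)) \<le> h * (w + h - w)"
    proof (rule integral_bound)
      show "norm (\<gamma> s - \<gamma> w) \<le> h" if "s \<in> {w..w + h}" for s
        using lipschitz_onD[OF L, of s w] that w by (auto simp: dist_norm)
    qed (use h in \<open>auto intro!: continuous_intros c\<close>)
    then have "norm (real (Suc n) *\<^sub>R integral {w..w + h} (\<lambda>s. \<gamma> s - \<gamma> w)) \<le> real (Suc n) * (h * h)"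
      unfolding norm_scaleR by (simp add: mult_left_mono)
    ultimately have "norm (real (Suc n) *\<^sub>R integral {w..w + h} \<gamma> - (real (Suc n) * h) *\<^sub>R \<gamma> w)
        \<le> (real (Suc n) * h) * h" by (simp only: mult.assoc)
    then have "norm (real (Suc n) *\<^sub>R integral {w..w + h} \<gamma> - \<gamma> w) \<le> h" by (simp only: h scaleR_one mult_1)
    then show ?thesis by (simp only: h_def)
  qed
  then show "\<forall>\<^sub>F n in sequentially.
      norm (real (Suc n) *\<^sub>R integral {w..w + 1 / real (Suc n)} \<gamma> - \<gamma> w) \<le> norm (1 / real (Suc n))"
    by simp
  show "(\<lambda>n. 1 / real (Suc n)) \<longlonglongrightarrow> 0" by (rule LIMSEQ_Suc[OF lim_1_over_n])
qed

lemma integral_diff_quot_tendsto: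
  assumes L: "1-lipschitz_on {0..} \<gamma>" and uv: "0 \<le> u" "u \<le> v"
  shows "(\<lambda>n. integral {u..v} (diff_quot \<gamma> n)) \<longlonglongrightarrow> \<gamma> v - \<gamma> u"
proof -
  have c: "continuous_on {a..b} \<gamma>" if "0 \<le> a" for a b
    by (rule continuous_on_subset[OF lipschitz_on_continuous_on[OF L]]) (use that in auto)
  have i: "\<gamma> integrable_on {a..b}" if "0 \<le> a" for a b
    by (rule integrable_continuous_real[OF c[OF that]])
  have "integral {u..v} (diff_quot \<gamma> n)
      = real (Suc n) *\<^sub>R integral {v..v + 1 / real (Suc n)} \<gamma>
        - real (Suc n) *\<^sub>R integral {u..u + 1 / real (Suc n)} \<gamma>" for n
  proof -
    define h where "h = 1 / real (Suc n)"
    have h: "h > 0" by (auto simp: h_def)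
    have s: "integral {u..v} (\<lambda>t. \<gamma> (t + h)) = integral {u + h..v + h} \<gamma>"
      using integral_shift_real_ivl[of "u + h" h "v + h" "\<gamma>"] by simp
    have "continuous_on {u..v} (\<lambda>t. \<gamma> (t + h))"
      by (rule continuous_on_compose2[OF c[of u "v + h"]]) (use uv h in \<open>auto intro!: continuous_intros\<close>)
    then have "integral {u..v} (diff_quot \<gamma> n)
        = real (Suc n) *\<^sub>R (integral {u + h..v + h} \<gamma> - integral {u..v} \<gamma>)"
      unfolding diff_quot_def h_def[symmetric] s[symmetric]
      by (simp add: integral_diff integrable_continuous_real i uv)
    also have "integral {u + h..v + h} \<gamma> - integral {u..v} \<gamma>
        = integral {v..v + h} \<gamma> - integral {u..u + h} \<gamma>"
      using Henstock_Kurzweil_Integration.integral_combine[of u v "v + h" \<gamma>] Henstock_Kurzweil_Integration.integral_combine[of u "u + h" "v + h" \<gamma>] uv h i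
      by (auto simp: algebra_simps)
    finally show ?thesis by (simp add: h_def scaleR_right_diff_distrib)
  qed
  then show ?thesis
    using tendsto_diff[OF average_tendsto[OF L, of v] average_tendsto[OF L, of u]] uv by simp
qed

text \<open>
  The main estimate: for a fixed \<open>n\<close>, the Stieltjes sums for the integrator \<open>\<integral> diff_quot \<gamma> n\<close>
  approximate the integral of \<open>f\<close> at a rate that depends on the oscillation of \<open>f\<close> only, hence
  uniformly in \<open>n\<close>.
\<close>

lemma stieltjes_sum_close:
  fixes f :: "real \<Rightarrow> 'a::{complex_normed_vector, banach}"
  assumes L: "1-lipschitz_on {0..} \<gamma>" and ab: "0 \<le> a" "a \<le> b" and f: "continuous_on {a..b} f"
    and p: "p tagged_division_of {a..b}" "(\<lambda>t. ball t \<delta>) fine p"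
    and osc: "\<And>s t. s \<in> {a..b} \<Longrightarrow> t \<in> {a..b} \<Longrightarrow> \<bar>s - t\<bar> < \<delta> \<Longrightarrow> norm (f t - f s) \<le> e"
  shows "norm ((\<Sum>(t, k)\<in>p. integral k (diff_quot \<gamma> n) *\<^sub>C f t)
      - integral {a..b} (\<lambda>s. diff_quot \<gamma> n s *\<^sub>C f s)) \<le> e * (b - a)"
proof -
  let ?D = "diff_quot \<gamma> n"
  note bb = bounded_bilinear.continuous_on[OF bounded_bilinear_scaleC]
  have cD: "continuous_on {u..v} ?D" if "a \<le> u" for u v
    by (rule continuous_on_diff_quot[OF L]) (use that ab in auto)
  have "(\<lambda>s. ?D s *\<^sub>C f s) integrable_on {a..b}"
    by (intro integrable_continuous_real bb cD f) auto
  then have "integral {a..b} (\<lambda>s. ?D s *\<^sub>C f s) = (\<Sum>(t, k)\<in>p. integral k (\<lambda>s. ?D s *\<^sub>C f s))"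
    using integral_combine_tagged_division_topdown[of _ a b p] p(1) by simp
  then have "(\<Sum>(t, k)\<in>p. integral k ?D *\<^sub>C f t) - integral {a..b} (\<lambda>s. ?D s *\<^sub>C f s)
      = (\<Sum>(t, k)\<in>p. integral k ?D *\<^sub>C f t - integral k (\<lambda>s. ?D s *\<^sub>C f s))"
    by (simp add: sum_subtractf case_prod_unfold)
  also have "norm \<dots> \<le> (\<Sum>(t, k)\<in>p. e * (Sup k - Inf k))"
  proof (rule sum_norm_le, clarify)
    fix t k assume tk: "(t, k) \<in> p"
    obtain u v where k: "k = {u..v}" using tagged_division_ofD(4)[OF p(1) tk] by auto
    have tk': "t \<in> {u..v}" "{u..v} \<subseteq> {a..b}"
      using tagged_division_ofD(2,3)[OF p(1) tk] k by auto
    have "{u..v} \<subseteq> ball t \<delta>" using p(2) tk k by (auto simp: fine_def)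
    then have d: "\<bar>s - t\<bar> < \<delta>" if "s \<in> {u..v}" for s
      using that by (auto simp: dist_real_def subset_eq abs_minus_commute)
    have uv: "a \<le> u" "u \<le> v" "v \<le> b" using tk' by auto
    have cf: "continuous_on {u..v} f" by (rule continuous_on_subset[OF f tk'(2)])
    have "integral k ?D *\<^sub>C f t = integral k (\<lambda>s. ?D s *\<^sub>C f t)"
      unfolding k
      using integral_linear[OF integrable_continuous_real[OF cD[OF uv(1)]]
          bounded_bilinear.bounded_linear_left[OF bounded_bilinear_scaleC], of v "f t"]
      by (simp add: comp_def)
    also have "\<dots> - integral k (\<lambda>s. ?D s *\<^sub>C f s) = integral k (\<lambda>s. ?D s *\<^sub>C (f t - f s))"
      unfolding k scaleC_diff_right
      by (intro integral_diff[symmetric] integrable_continuous_real bb cD cf uv continuous_intros)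
    also have "norm \<dots> \<le> e * (v - u)"
      unfolding k
    proof (rule integral_bound[OF uv(2)])
      show "continuous_on {u..v} (\<lambda>s. ?D s *\<^sub>C (f t - f s))"
        by (intro bb cD cf uv continuous_intros)
      fix s assume s: "s \<in> {u..v}"
      have "norm (?D s *\<^sub>C (f t - f s)) \<le> 1 * e"
        unfolding norm_scaleC
        using s uv ab tk' d[OF s]
        by (intro mult_mono norm_diff_quot_le[OF L] osc) auto
      then show "norm (?D s *\<^sub>C (f t - f s)) \<le> e" by simp
    qed
    finally show "norm (integral k ?D *\<^sub>C f t - integral k (\<lambda>s. ?D s *\<^sub>C f s)) \<le> e * (Sup k - Inf k)"
      using uv k by simp
  qed
  also have "\<dots> = e * (b - a)"
    using additive_tagged_division_1[OF ab(2) p(1), of "\<lambda>x. x"]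
    by (simp add: case_prod_unfold flip: sum_distrib_left)
  finally show ?thesis .
qed

text \<open>
  The Stieltjes integral is the limit of the integrals against the difference quotients; they form
  a Cauchy sequence because a single fine tagged division approximates all of them.
\<close>

lemma has_line_integral_exists:
  fixes F :: "complex \<Rightarrow> 'a::{complex_normed_vector, banach}"
  assumes L: "1-lipschitz_on {0..} \<gamma>" and ab: "0 \<le> a" "a \<le> b"
    and F: "continuous_on {a..b} (\<lambda>t. F (\<gamma> t))"
  obtains J where "has_line_integral F J \<gamma> a b"
    and "(\<lambda>n. integral {a..b} (\<lambda>t. diff_quot \<gamma> n t *\<^sub>C F (\<gamma> t))) \<longlonglongrightarrow> J"
proof -
  define I where "I n = integral {a..b} (\<lambda>t. diff_quot \<gamma> n t *\<^sub>C F (\<gamma> t))" for n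
  define S where "S n p = (\<Sum>(t, k)\<in>p. integral k (diff_quot \<gamma> n) *\<^sub>C F (\<gamma> t))" for n and p :: "(real \<times> real set) set"
  define R where "R p = (\<Sum>(t, k)\<in>p. (\<gamma> (Sup k) - \<gamma> (Inf k)) *\<^sub>C F (\<gamma> t))" for p
  have SR: "(\<lambda>n. S n p) \<longlonglongrightarrow> R p" if p: "p tagged_division_of {a..b}" for p
    unfolding S_def R_def case_prod_unfold
  proof (intro tendsto_sum bounded_bilinear.tendsto[OF bounded_bilinear_scaleC] tendsto_const)
    fix x assume x: "x \<in> p"
    obtain t k where tk: "x = (t, k)" by (cases x)
    obtain u v where k: "k = {u..v}" using tagged_division_ofD(4)[OF p x[unfolded tk]] by auto
    have "t \<in> {u..v}" "{u..v} \<subseteq> {a..b}"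
      using tagged_division_ofD(2,3)[OF p x[unfolded tk]] k by auto
    then have "0 \<le> u" "u \<le> v" using ab by auto
    from integral_diff_quot_tendsto[OF L this]
    show "(\<lambda>n. integral (snd x) (diff_quot \<gamma> n)) \<longlonglongrightarrow> \<gamma> (Sup (snd x)) - \<gamma> (Inf (snd x))"
      using \<open>u \<le> v\<close> by (simp add: tk k)
  qed
  have close: "\<exists>\<delta>>0. \<forall>p n. p tagged_division_of {a..b} \<and> (\<lambda>t. ball t \<delta>) fine p \<longrightarrow>
      norm (S n p - I n) \<le> e" if e: "e > 0" for e
  proof -
    define e' where "e' = e / (b - a + 1)"
    have e': "e' > 0" using e ab by (simp add: e'_def)
    have "uniformly_continuous_on {a..b} (\<lambda>t. F (\<gamma> t))"
      by (rule compact_uniformly_continuous[OF F]) simp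
    then obtain \<delta> where \<delta>: "\<delta> > 0" and osc: "\<And>s t. s \<in> {a..b} \<Longrightarrow> t \<in> {a..b} \<Longrightarrow>
        dist t s < \<delta> \<Longrightarrow> dist (F (\<gamma> t)) (F (\<gamma> s)) < e'"
      using e' by (rule uniformly_continuous_onE) blast
    have "norm (F (\<gamma> t) - F (\<gamma> s)) \<le> e'" if "s \<in> {a..b}" "t \<in> {a..b}" "\<bar>s - t\<bar> < \<delta>" for s t
      using osc[of s t] that by (simp add: dist_norm abs_minus_commute)
    note close' = stieltjes_sum_close[OF L ab F _ _ this]
    have "norm (S n p - I n) \<le> e' * (b - a)"
      if "p tagged_division_of {a..b}" "(\<lambda>t. ball t \<delta>) fine p" for n p
      unfolding S_def I_def by (rule close'[OF that])
    moreover have "e' * (b - a) \<le> e' * (b - a + 1)" using e' by simp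
    then have "e' * (b - a) \<le> e" using ab by (simp add: e'_def)
    ultimately show ?thesis using \<delta> by (intro exI[of _ \<delta>]) (auto intro: order_trans)
  qed
  have "Cauchy I"
  proof (rule CauchyI)
    fix e :: real assume e: "e > 0"
    then obtain \<delta> where \<delta>: "\<delta> > 0" and c: "\<And>p n. p tagged_division_of {a..b} \<Longrightarrow> (\<lambda>t. ball t \<delta>) fine p \<Longrightarrow>
        norm (S n p - I n) \<le> e / 4" using close[of "e / 4"] by auto
    have "gauge (\<lambda>t::real. ball t \<delta>)" using \<delta> by (rule gauge_ball)
    then obtain p where p: "p tagged_division_of {a..b}" "(\<lambda>t. ball t \<delta>) fine p"
      by (rule fine_division_exists_real)
    obtain N where N: "\<And>m n. m \<ge> N \<Longrightarrow> n \<ge> N \<Longrightarrow> norm (S m p - S n p) < e / 4"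
      using CauchyD[OF LIMSEQ_imp_Cauchy[OF SR[OF p(1)]], of "e / 4"] e by auto
    have "norm (I m - I n) < e" if "m \<ge> N" "n \<ge> N" for m n
    proof -
      have "I m - I n = (S m p - S n p) - (S m p - I m) + (S n p - I n)" by simp
      also have "norm \<dots> \<le> norm (S m p - S n p) + norm (S m p - I m) + norm (S n p - I n)"
        by (intro order_trans[OF norm_triangle_ineq] add_right_mono norm_triangle_ineq4)
      also have "\<dots> < e" using N[OF that] c[OF p, of m] c[OF p, of n] e by linarith
      finally show ?thesis .
    qed
    then show "\<exists>M. \<forall>m\<ge>M. \<forall>n\<ge>M. norm (I m - I n) < e" by blast
  qed
  then obtain J where J: "I \<longlonglongrightarrow> J" using Cauchy_convergent convergent_def by blast
  have "has_line_integral F J \<gamma> a b"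
    unfolding has_line_integral_def
  proof (intro allI impI)
    fix e :: real assume e: "e > 0"
    then obtain \<delta> where \<delta>: "\<delta> > 0" and c: "\<And>p n. p tagged_division_of {a..b} \<Longrightarrow> (\<lambda>t. ball t \<delta>) fine p \<Longrightarrow>
        norm (S n p - I n) \<le> e / 2" using close[of "e / 2"] by auto
    have "norm (R p - J) < e" if p: "p tagged_division_of {a..b}" "(\<lambda>t. ball t \<delta>) fine p" for p
    proof -
      have "norm (R p - J) \<le> e / 2"
        by (rule Lim_norm_ubound[OF trivial_limit_sequentially tendsto_diff[OF SR[OF p(1)] J]])
          (intro always_eventually allI c[OF p])
      with e show ?thesis by simp
    qed
    with \<delta> show "\<exists>\<delta>>0. \<forall>p. p tagged_division_of {a..b} \<and> (\<lambda>t. ball t \<delta>) fine p \<longrightarrow>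
        norm ((\<Sum>(t, k)\<in>p. (\<gamma> (Sup k) - \<gamma> (Inf k)) *\<^sub>C F (\<gamma> t)) - J) < e"
      unfolding R_def by blast
  qed
  with J show ?thesis unfolding I_def by (intro that)
qed

lemma has_line_integral_diff:
  assumes "has_line_integral F I \<gamma> a b" "has_line_integral G J \<gamma> a b"
  shows "has_line_integral (\<lambda>\<mu>. F \<mu> - G \<mu>) (I - J) \<gamma> a b"
  unfolding has_line_integral_def
proof (intro allI impI)
  fix e :: real assume "e > 0"
  then have e: "e / 2 > 0" by simp
  let ?S = "\<lambda>F p. (\<Sum>(t, k)\<in>p. (\<gamma> (Sup k) - \<gamma> (Inf k)) *\<^sub>C F (\<gamma> t))"
  obtain d1 where d1: "d1 > 0" "\<And>p. p tagged_division_of {a..b} \<Longrightarrow> (\<lambda>t. ball t d1) fine p \<Longrightarrow>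
      norm (?S F p - I) < e / 2"
    using assms(1)[unfolded has_line_integral_def, rule_format, OF e] by auto
  obtain d2 where d2: "d2 > 0" "\<And>p. p tagged_division_of {a..b} \<Longrightarrow> (\<lambda>t. ball t d2) fine p \<Longrightarrow>
      norm (?S G p - J) < e / 2"
    using assms(2)[unfolded has_line_integral_def, rule_format, OF e] by auto
  have "norm (?S (\<lambda>\<mu>. F \<mu> - G \<mu>) p - (I - J)) < e"
    if p: "p tagged_division_of {a..b}" "(\<lambda>t. ball t (min d1 d2)) fine p" for p
  proof -
    have f: "(\<lambda>t. ball t d1) fine p" "(\<lambda>t. ball t d2) fine p"
      using p(2) unfolding fine_def by fastforce+
    have "?S (\<lambda>\<mu>. F \<mu> - G \<mu>) p - (I - J) = (?S F p - I) - (?S G p - J)"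
      by (simp add: scaleC_diff_right sum_subtractf case_prod_unfold)
    also have "norm \<dots> \<le> norm (?S F p - I) + norm (?S G p - J)" by (rule norm_triangle_ineq4)
    also have "\<dots> < e" using d1(2)[OF p(1) f(1)] d2(2)[OF p(1) f(2)] by simp
    finally show ?thesis .
  qed
  then show "\<exists>\<delta>>0. \<forall>p. p tagged_division_of {a..b} \<and> (\<lambda>t. ball t \<delta>) fine p \<longrightarrow>
      norm (?S (\<lambda>\<mu>. F \<mu> - G \<mu>) p - (I - J)) < e"
    using d1(1) d2(1) by (intro exI[of _ "min d1 d2"]) auto
qed

lemma has_line_integral_unique:
  assumes "has_line_integral F I \<gamma> a b" "has_line_integral F J \<gamma> a b"
  shows "I = J"
proof (rule ccontr)
  assume "I \<noteq> J"
  then have "norm (I - J) > 0" by simp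
  from has_line_integral_diff[OF assms, unfolded has_line_integral_def, rule_format, OF this]
  obtain \<delta> where \<delta>: "\<delta> > 0" "\<forall>p. p tagged_division_of {a..b} \<and> (\<lambda>t. ball t \<delta>) fine p \<longrightarrow>
      norm ((\<Sum>(t, k)\<in>p. (\<gamma> (Sup k) - \<gamma> (Inf k)) *\<^sub>C (F (\<gamma> t) - F (\<gamma> t))) - (I - J)) < norm (I - J)"
    by (elim exE conjE) (rule that)
  have "gauge (\<lambda>t::real. ball t \<delta>)" using \<delta>(1) by (rule gauge_ball)
  then obtain p where p: "p tagged_division_of {a..b}" "(\<lambda>t. ball t \<delta>) fine p"
    by (rule fine_division_exists_real)
  with \<delta>(2) have "norm ((\<Sum>(t, k)\<in>p. (\<gamma> (Sup k) - \<gamma> (Inf k)) *\<^sub>C (F (\<gamma> t) - F (\<gamma> t))) - (I - J))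
      < norm (I - J)" by blast
  then show False by (simp add: case_prod_unfold norm_minus_commute)
qed

lemma line_integral_tendsto:
  fixes F :: "complex \<Rightarrow> 'a::{complex_normed_vector, banach}"
  assumes "1-lipschitz_on {0..} \<gamma>" "0 \<le> a" "a \<le> b" "continuous_on {a..b} (\<lambda>t. F (\<gamma> t))"
    and "has_line_integral F J \<gamma> a b"
  shows "(\<lambda>n. integral {a..b} (\<lambda>t. diff_quot \<gamma> n t *\<^sub>C F (\<gamma> t))) \<longlonglongrightarrow> J"
proof -
  obtain J' where J': "has_line_integral F J' \<gamma> a b"
    "(\<lambda>n. integral {a..b} (\<lambda>t. diff_quot \<gamma> n t *\<^sub>C F (\<gamma> t))) \<longlonglongrightarrow> J'"
    by (rule has_line_integral_exists[OF assms(1-4)])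
  then show ?thesis using has_line_integral_unique[OF assms(5)] by simp
qed

lemma norm_line_integral_le:
  fixes F :: "complex \<Rightarrow> 'a::{complex_normed_vector, banach}"
  assumes L: "1-lipschitz_on {0..} \<gamma>" and ab: "0 \<le> a" "a \<le> b"
    and F: "continuous_on {a..b} (\<lambda>t. F (\<gamma> t))" and J: "has_line_integral F J \<gamma> a b"
  shows "norm J \<le> integral {a..b} (\<lambda>t. norm (F (\<gamma> t)))"
proof (rule Lim_norm_ubound[OF _ line_integral_tendsto[OF assms]])
  show "\<forall>\<^sub>F n in sequentially. norm (integral {a..b} (\<lambda>t. diff_quot \<gamma> n t *\<^sub>C F (\<gamma> t)))
      \<le> integral {a..b} (\<lambda>t. norm (F (\<gamma> t)))"
  proof (rule always_eventually, rule allI, rule integral_norm_bound_integral)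
    fix n t assume "t \<in> {a..b}"
    then show "norm (diff_quot \<gamma> n t *\<^sub>C F (\<gamma> t)) \<le> norm (F (\<gamma> t))"
      unfolding norm_scaleC using ab
      by (intro mult_left_le_one_le norm_diff_quot_le[OF L]) auto
  qed (intro integrable_continuous_real continuous_intros F continuous_on_diff_quot[OF L ab(1)]
      bounded_bilinear.continuous_on[OF bounded_bilinear_scaleC])+
qed simp

lemma line_integral_combine:
  fixes F :: "complex \<Rightarrow> 'a::{complex_normed_vector, banach}"
  assumes L: "1-lipschitz_on {0..} \<gamma>" and abc: "0 \<le> a" "a \<le> b" "b \<le> c"
    and F: "continuous_on {a..c} (\<lambda>t. F (\<gamma> t))"
    and I: "has_line_integral F I \<gamma> a b" and J: "has_line_integral F J \<gamma> b c"
    and K: "has_line_integral F K \<gamma> a c"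
  shows "K = I + J"
proof (rule LIMSEQ_unique)
  let ?f = "\<lambda>n t. diff_quot \<gamma> n t *\<^sub>C F (\<gamma> t)"
  have F': "continuous_on {a..b} (\<lambda>t. F (\<gamma> t))" "continuous_on {b..c} (\<lambda>t. F (\<gamma> t))"
    by (rule continuous_on_subset[OF F], use abc in auto)+
  show "(\<lambda>n. integral {a..c} (?f n)) \<longlonglongrightarrow> K"
    by (rule line_integral_tendsto[OF L _ _ F K]) (use abc in auto)
  have "integral {a..b} (?f n) + integral {b..c} (?f n) = integral {a..c} (?f n)" for n
    by (rule Henstock_Kurzweil_Integration.integral_combine[OF abc(2,3)])
      (intro integrable_continuous_real F continuous_on_diff_quot[OF L] abc
        bounded_bilinear.continuous_on[OF bounded_bilinear_scaleC])
  moreover have "(\<lambda>n. integral {a..b} (?f n) + integral {b..c} (?f n)) \<longlonglongrightarrow> I + J"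
    by (intro tendsto_add line_integral_tendsto L F' I J) (use abc in auto)
  ultimately show "(\<lambda>n. integral {a..c} (?f n)) \<longlonglongrightarrow> I + J" by simp
qed


section \<open>Improper line integrals\<close>

lemma has_improper_line_integral_diff:
  assumes "has_improper_line_integral F I \<gamma>" "has_improper_line_integral G J \<gamma>"
  shows "has_improper_line_integral (\<lambda>\<mu>. F \<mu> - G \<mu>) (I - J) \<gamma>"
proof -
  obtain P where P: "\<And>a b. 0 < a \<Longrightarrow> a \<le> b \<Longrightarrow> has_line_integral F (P a b) \<gamma> a b"
    "((\<lambda>(a, b). P a b) \<longlongrightarrow> I) (at_right 0 \<times>\<^sub>F at_top)"
    using assms(1) unfolding has_improper_line_integral_def by blast
  obtain Q where Q: "\<And>a b. 0 < a \<Longrightarrow> a \<le> b \<Longrightarrow> has_line_integral G (Q a b) \<gamma> a b"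
    "((\<lambda>(a, b). Q a b) \<longlongrightarrow> J) (at_right 0 \<times>\<^sub>F at_top)"
    using assms(2) unfolding has_improper_line_integral_def by blast
  have "((\<lambda>(a, b). P a b - Q a b) \<longlongrightarrow> I - J) (at_right 0 \<times>\<^sub>F at_top)"
    using tendsto_diff[OF P(2) Q(2)] by (simp add: case_prod_unfold)
  then show ?thesis
    unfolding has_improper_line_integral_def
    using has_line_integral_diff[OF P(1) Q(1)]
    by (intro exI[of _ "\<lambda>a b. P a b - Q a b"]) auto
qed

lemma eventually_at_right_0_at_top:
  assumes "\<And>a b. 0 < a \<Longrightarrow> a \<le> c \<Longrightarrow> d \<le> b \<Longrightarrow> P a b" "c > 0"
  shows "\<forall>\<^sub>F (a, b) in at_right (0::real) \<times>\<^sub>F (at_top :: real filter). P a b"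
proof -
  have "\<forall>\<^sub>F a in at_right 0. 0 < a \<and> a \<le> c"
    using assms(2) by (auto simp: eventually_at_right intro!: exI[of _ c])
  moreover have "\<forall>\<^sub>F b in at_top. d \<le> b" by (rule eventually_ge_at_top)
  ultimately show ?thesis
    unfolding eventually_prod_filter
    by (intro exI[of _ "\<lambda>a. 0 < a \<and> a \<le> c"] exI[of _ "\<lambda>b. d \<le> b"]) (simp add: assms(1))
qed

lemma has_improper_line_integral_unique:
  assumes "has_improper_line_integral F I \<gamma>" "has_improper_line_integral F J \<gamma>"
  shows "I = J"
proof -
  obtain P where P: "\<And>a b. 0 < a \<Longrightarrow> a \<le> b \<Longrightarrow> has_line_integral F (P a b) \<gamma> a b"
    "((\<lambda>(a, b). P a b) \<longlongrightarrow> I) (at_right 0 \<times>\<^sub>F at_top)"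
    using assms(1) unfolding has_improper_line_integral_def by blast
  obtain Q where Q: "\<And>a b. 0 < a \<Longrightarrow> a \<le> b \<Longrightarrow> has_line_integral F (Q a b) \<gamma> a b"
    "((\<lambda>(a, b). Q a b) \<longlongrightarrow> J) (at_right 0 \<times>\<^sub>F at_top)"
    using assms(2) unfolding has_improper_line_integral_def by blast
  have "\<forall>\<^sub>F (a, b) in at_right (0::real) \<times>\<^sub>F at_top. P a b = Q a b"
    by (rule eventually_at_right_0_at_top[of 1 1])
      (auto intro: has_line_integral_unique[OF P(1) Q(1)])
  then have "((\<lambda>(a, b). P a b) \<longlongrightarrow> J) (at_right 0 \<times>\<^sub>F at_top)"
    using Q(2) by (subst tendsto_cong[where g = "\<lambda>(a, b). Q a b"]) (auto simp: case_prod_unfold)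
  with P(2) show ?thesis
    by (rule tendsto_unique[rotated]) (simp add: prod_filter_eq_bot)
qed

lemma set_integrable_Icc_le:
  fixes g :: "real \<Rightarrow> real"
  assumes g: "set_integrable lborel {0<..} g" and nn: "\<And>t. g t \<ge> 0" and a: "0 < a"
  shows "g integrable_on {a..b}"
    and "integral {a..b} g \<le> (LINT t:{0<..}|lborel. g t)"
proof -
  have sub: "set_integrable lborel {a..b} g"
    by (rule set_integrable_subset[OF g]) (use a in auto)
  show "g integrable_on {a..b}" by (rule set_borel_integral_eq_integral(1)[OF sub])
  show "integral {a..b} g \<le> (LINT t:{0<..}|lborel. g t)"
    unfolding set_borel_integral_eq_integral(2)[OF sub] set_borel_integral_eq_integral(2)[OF g]
    by (rule integral_subset_le)
      (use a nn set_borel_integral_eq_integral(1)[OF sub] set_borel_integral_eq_integral(1)[OF g] in auto)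
qed

lemma set_integral_exhaust_tendsto:
  fixes g :: "real \<Rightarrow> real"
  assumes g: "set_integrable lborel {0<..} g"
  shows "(\<lambda>n. integral {1 / real (Suc n)..real (Suc n)} g) \<longlonglongrightarrow> (LINT t:{0<..}|lborel. g t)"
proof -
  define A where "A n = {1 / real (Suc n)..real (Suc n)}" for n
  have pos: "0 < 1 / real (Suc n)" for n by simp
  have sub: "A n \<subseteq> {0<..}" for n
    unfolding A_def using less_le_trans[OF pos[of n]] by (simp add: subset_eq del: of_nat_Suc)
  have inc: "incseq A"
  proof (rule incseq_SucI)
    fix n
    have "1 / real (Suc (Suc n)) \<le> 1 / real (Suc n)" by (simp add: frac_le)
    then show "A n \<subseteq> A (Suc n)" by (auto simp: A_def)
  qed
  have un: "(\<Union>n. A n) = {0<..}"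
  proof
    show "(\<Union>n. A n) \<subseteq> {0<..}" using sub by auto
    show "{0<..} \<subseteq> (\<Union>n. A n)"
    proof
      fix x :: real assume "x \<in> {0<..}"
      then have x: "x > 0" by simp
      obtain n where n: "max x (1 / x) < real n" using reals_Archimedean2 by blast
      then have "x \<le> real (Suc n)" "1 / x \<le> real (Suc n)" by auto
      then have "x \<in> A n" using x by (auto simp: A_def field_simps)
      then show "x \<in> (\<Union>n. A n)" by blast
    qed
  qed
  have "(\<lambda>n. LINT t:A n|lborel. g t) \<longlonglongrightarrow> (LINT t:(\<Union>n. A n)|lborel. g t)"
    by (rule set_integral_cont_up[OF _ inc]) (simp_all add: un g, simp add: A_def)
  then have "(\<lambda>n. LINT t:A n|lborel. g t) \<longlonglongrightarrow> (LINT t:{0<..}|lborel. g t)" by (simp only: un)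
  moreover have "(LINT t:A n|lborel. g t) = integral (A n) g" for n
    by (rule set_borel_integral_eq_integral(2), rule set_integrable_subset[OF g])
      (use sub in \<open>auto simp: A_def\<close>)
  ultimately show ?thesis by (simp add: A_def)
qed

lemma norm_improper_line_integral_le:
  fixes F :: "complex \<Rightarrow> 'a::{complex_normed_vector, banach}"
  assumes L: "1-lipschitz_on {0..} \<gamma>" and F: "continuous_on {0<..} (\<lambda>t. F (\<gamma> t))"
    and int: "set_integrable lborel {0<..} (\<lambda>t. norm (F (\<gamma> t)))"
    and I: "has_improper_line_integral F I \<gamma>"
  shows "norm I \<le> (LINT t:{0<..}|lborel. norm (F (\<gamma> t)))"
proof -
  obtain P where P: "\<And>a b. 0 < a \<Longrightarrow> a \<le> b \<Longrightarrow> has_line_integral F (P a b) \<gamma> a b"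
    "((\<lambda>(a, b). P a b) \<longlongrightarrow> I) (at_right 0 \<times>\<^sub>F at_top)"
    using I unfolding has_improper_line_integral_def by blast
  have "norm (P a b) \<le> (LINT t:{0<..}|lborel. norm (F (\<gamma> t)))" if "0 < a" "a \<le> b" for a b
  proof -
    have "norm (P a b) \<le> integral {a..b} (\<lambda>t. norm (F (\<gamma> t)))"
      by (rule norm_line_integral_le[OF L _ _ continuous_on_subset[OF F] P(1)]) (use that in auto)
    also have "\<dots> \<le> (LINT t:{0<..}|lborel. norm (F (\<gamma> t)))"
      by (rule set_integrable_Icc_le(2)[OF int]) (use that in auto)
    finally show ?thesis .
  qed
  then have "\<forall>\<^sub>F (a, b) in at_right (0::real) \<times>\<^sub>F at_top.
      norm (P a b) \<le> (LINT t:{0<..}|lborel. norm (F (\<gamma> t)))"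
    by (intro eventually_at_right_0_at_top[of 1 1]) auto
  then show ?thesis
    by (intro Lim_norm_ubound[OF _ P(2)]) (auto simp: prod_filter_eq_bot case_prod_unfold)
qed

text \<open>
  An absolutely integrable continuous integrand has an improper integral: the remainders are
  dominated by the tails of \<open>\<integral> \<parallel>F(\<gamma>(t))\<parallel> dt\<close>.
\<close>

lemma has_improper_line_integral_exists:
  fixes F :: "complex \<Rightarrow> 'a::{complex_normed_vector, banach}"
  assumes L: "1-lipschitz_on {0..} \<gamma>" and F: "continuous_on {0<..} (\<lambda>t. F (\<gamma> t))"
    and int: "set_integrable lborel {0<..} (\<lambda>t. norm (F (\<gamma> t)))"
  obtains I where "has_improper_line_integral F I \<gamma>"
proof -
  define g where "g t = norm (F (\<gamma> t))" for t
  define M where "M = (LINT t:{0<..}|lborel. g t)"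
  have int': "set_integrable lborel {0<..} g" using int by (simp add: g_def[abs_def])
  have nn: "g t \<ge> 0" for t by (simp add: g_def)
  note ig = set_integrable_Icc_le(1)[OF int' nn] and iM = set_integrable_Icc_le(2)[OF int' nn]
  have F': "continuous_on {a..b} (\<lambda>t. F (\<gamma> t))" if "0 < a" for a b
    by (rule continuous_on_subset[OF F]) (use that in auto)
  have ex: "\<exists>J. has_line_integral F J \<gamma> a b" if "0 < a" "a \<le> b" for a b
    using has_line_integral_exists[OF L less_imp_le[OF that(1)] that(2) F'[OF that(1)]] by blast
  define P where "P a b = (SOME J. has_line_integral F J \<gamma> a b)" for a b
  have P: "has_line_integral F (P a b) \<gamma> a b" if "0 < a" "a \<le> b" for a b
    unfolding P_def by (rule someI_ex[OF ex[OF that]])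
  have near: "norm (P a b - P x y) \<le> M - integral {x..y} g" if "0 < a" "a \<le> x" "x \<le> y" "y \<le> b" for a b x y
  proof -
    have 1: "P a b = P a x + P x b"
      by (rule line_integral_combine[OF L _ _ _ F' P P P]) (use that in auto)
    have 2: "P x b = P x y + P y b"
      by (rule line_integral_combine[OF L _ _ _ F' P P P]) (use that in auto)
    have "norm (P a b - P x y) \<le> norm (P a x) + norm (P y b)"
      unfolding 1 2 by (simp add: norm_triangle_ineq)
    also have "\<dots> \<le> integral {a..x} g + integral {y..b} g"
      unfolding g_def
      by (intro add_mono norm_line_integral_le[OF L _ _ F' P]) (use that in auto)
    also have "\<dots> = integral {a..b} g - integral {x..y} g"
      using Henstock_Kurzweil_Integration.integral_combine[of a x b g] Henstock_Kurzweil_Integration.integral_combine[of x y b g] ig that by auto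
    also have "\<dots> \<le> M - integral {x..y} g"
      unfolding M_def by (intro diff_right_mono iM that)
    finally show ?thesis .
  qed
  define x where "x n = 1 / real (Suc n)" for n
  define y where "y n = real (Suc n)" for n
  \<comment> \<open>\<open>\<tau> n\<close> is the part of the norm integral outside the compact parameter interval \<open>[x n, y n]\<close>.\<close>
  define \<tau> where "\<tau> n = M - integral {x n..y n} g" for n
  have xy: "0 < x n" "x n \<le> y n" for n by (auto simp: x_def y_def divide_le_eq intro: order_trans[of 1 "real (Suc n)"])
  have mono: "x n \<le> x m" "y m \<le> y n" if "m \<le> n" for m n
    using that by (auto simp: x_def y_def frac_le)
  have \<tau>0: "\<tau> \<longlonglongrightarrow> 0"
    using tendsto_diff[OF tendsto_const[of M] set_integral_exhaust_tendsto[OF int']]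
    by (simp add: \<tau>_def[abs_def] M_def x_def y_def)
  define Q where "Q n = P (x n) (y n)" for n
  have Q: "norm (P a b - Q n) \<le> \<tau> n" if "0 < a" "a \<le> x n" "y n \<le> b" for a b n
    unfolding Q_def \<tau>_def by (rule near) (use that xy in auto)
  have QQ: "norm (Q m - Q n) \<le> \<tau> n" if "n \<le> m" for m n
    unfolding Q_def[of m] by (rule Q) (use that xy mono in auto)
  have "Cauchy Q"
  proof (rule CauchyI')
    fix e :: real assume "e > 0"
    then obtain N where N: "\<And>n. n \<ge> N \<Longrightarrow> \<bar>\<tau> n\<bar> < e"
      using \<tau>0 by (auto simp: LIMSEQ_iff)
    show "\<exists>M. \<forall>m\<ge>M. \<forall>n>m. dist (Q m) (Q n) < e"
    proof (intro exI allI impI)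
      fix m n assume "N \<le> m" "m < n"
      then show "dist (Q m) (Q n) < e"
        using QQ[of m n] N[of m] by (simp add: dist_norm norm_minus_commute)
    qed
  qed
  then obtain I where I: "Q \<longlonglongrightarrow> I" using Cauchy_convergent convergent_def by blast
  have "((\<lambda>(a, b). P a b) \<longlongrightarrow> I) (at_right 0 \<times>\<^sub>F at_top)"
  proof (rule tendstoI)
    fix e :: real assume e: "e > 0"
    then have e2: "e / 2 > 0" by simp
    obtain n where n: "dist (Q n) I < e / 2" "dist (\<tau> n) 0 < e / 2"
      using eventually_happens'[OF sequentially_bot eventually_conj[OF tendstoD[OF I e2] tendstoD[OF \<tau>0 e2]]]
      by blast
    have "dist (P a b) I < e" if "0 < a" "a \<le> x n" "y n \<le> b" for a b
      using Q[OF that] n dist_triangle[of "P a b" I "Q n"] by (simp add: dist_norm)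
    then have "\<forall>\<^sub>F (a, b) in at_right (0::real) \<times>\<^sub>F at_top. dist (P a b) I < e"
      using xy(1) by (intro eventually_at_right_0_at_top[of "x n" "y n"])
    then show "\<forall>\<^sub>F z in at_right 0 \<times>\<^sub>F at_top. dist (case z of (a, b) \<Rightarrow> P a b) I < e"
      by (simp add: case_prod_unfold)
  qed
  with P have "has_improper_line_integral F I \<gamma>" unfolding has_improper_line_integral_def by blast
  then show ?thesis by (rule that)
qed


section \<open>The resolvent along the contour\<close>

lemma norm_bop_id_le: "norm (bop_id :: ('a::complex_normed_vector, 'a) bop) \<le> 1"
  by (rule norm_bop_le) auto

text \<open>
  \<open>\<parallel>(A + X - z)\<^sup>-\<^sup>1\<parallel> \<le> 1 / (dist(z, \<sigma>(A)) - \<parallel>X\<parallel>)\<close>. The invertibility is part of the claim, because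
  \<^const>\<open>bop_inverse\<close> is arbitrary on operators without bounded inverse.
\<close>

lemma perturbed_resolvent:
  fixes A :: "('a::complex_hilbert_space, 'a) bop"
  assumes sym: "\<And>x y. cinner (bop_apply A x) y = cinner x (bop_apply A y)"
    and real: "spectrum A \<subseteq> range complex_of_real"
    and X: "norm X < infdist z (spectrum A)"
  defines "R \<equiv> bop_inverse (A + X - z *\<^sub>C bop_id)"
  shows "R \<circ>\<^sub>B (A + X - z *\<^sub>C bop_id) = bop_id" "(A + X - z *\<^sub>C bop_id) \<circ>\<^sub>B R = bop_id"
    and "norm R \<le> 1 / (infdist z (spectrum A) - norm X)"
proof -
  have "infdist z (spectrum A) \<noteq> 0" using X norm_ge_zero[of X] by linarith
  then have "z \<notin> spectrum A" by auto
  then obtain S where S: "S \<circ>\<^sub>B (A - z *\<^sub>C bop_id) = bop_id" "(A - z *\<^sub>C bop_id) \<circ>\<^sub>B S = bop_id"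
    unfolding not_in_spectrum_iff by blast
  have low: "infdist z (spectrum A) * norm x \<le> norm (bop_apply (A - z *\<^sub>C bop_id) x)" for x
    by (rule symmetric_lower_bound[OF sym real]) (simp add: infdist_le flip: dist_norm)
  have eq: "A - z *\<^sub>C bop_id + X = A + X - z *\<^sub>C bop_id" by simp
  obtain Q where Q: "Q \<circ>\<^sub>B (A + X - z *\<^sub>C bop_id) = bop_id" "(A + X - z *\<^sub>C bop_id) \<circ>\<^sub>B Q = bop_id"
    "norm Q \<le> 1 / (infdist z (spectrum A) - norm X)"
    using invertible_perturbation[OF S low X] unfolding eq by blast
  then have "R = Q" unfolding R_def by (intro bop_inverse_eqI)
  with Q show "R \<circ>\<^sub>B (A + X - z *\<^sub>C bop_id) = bop_id" "(A + X - z *\<^sub>C bop_id) \<circ>\<^sub>B R = bop_id"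
    "norm R \<le> 1 / (infdist z (spectrum A) - norm X)" by simp_all
qed

lemma resolvent_identity:
  fixes Y :: "('a::complex_normed_vector, 'a) bop"
  assumes "R \<circ>\<^sub>B (Y - z *\<^sub>C bop_id) = bop_id" and "(Y - w *\<^sub>C bop_id) \<circ>\<^sub>B S = bop_id"
  shows "R - S = (z - w) *\<^sub>C (R \<circ>\<^sub>B S)"
proof (rule bop_eqI)
  fix x
  have s: "bop_apply Y (bop_apply S x) = x + w *\<^sub>C bop_apply S x"
    using bop_compose_eq_idD[OF assms(2), of x] by (simp add: algebra_simps)
  have "bop_apply S x = bop_apply R (x + w *\<^sub>C bop_apply S x) - z *\<^sub>C bop_apply R (bop_apply S x)"
    using bop_compose_eq_idD[OF assms(1), of "bop_apply S x"]
    by (simp add: s bop_apply_linear bop_apply_scaleC)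
  then have "bop_apply S x = bop_apply R x + w *\<^sub>C bop_apply R (bop_apply S x) - z *\<^sub>C bop_apply R (bop_apply S x)"
    by (simp only: bop_apply_linear bop_apply_scaleC)
  moreover have "b = a + c - e \<Longrightarrow> a - b = e - c" for a b c e :: 'a by simp
  ultimately have "bop_apply R x - bop_apply S x
      = z *\<^sub>C bop_apply R (bop_apply S x) - w *\<^sub>C bop_apply R (bop_apply S x)" by blast
  moreover have "(z - w) *\<^sub>C bop_apply R (bop_apply S x)
      = z *\<^sub>C bop_apply R (bop_apply S x) - w *\<^sub>C bop_apply R (bop_apply S x)"
    using scaleC_add_left[of z "- w" "bop_apply R (bop_apply S x)"] by (simp add: scaleC_minus_left)
  ultimately show "bop_apply (R - S) x = bop_apply ((z - w) *\<^sub>C (R \<circ>\<^sub>B S)) x"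
    by simp
qed

text \<open>
  The difference of \<open>Y (Y - z)\<^sup>-\<^sup>1\<close> and \<open>Y' (Y' - z)\<^sup>-\<^sup>1\<close> in a form whose norm can be bounded
  independently of \<open>\<bar>z\<bar>\<close>; the bound \<open>\<parallel>Y'\<parallel> \<le> \<parallel>A\<parallel> + r\<close> then leads exactly to \<^const>\<open>r_max\<close>.
\<close>

lemma transform_difference:
  fixes Y Y' :: "('a::complex_normed_vector, 'a) bop"
  assumes R: "(Y - z *\<^sub>C bop_id) \<circ>\<^sub>B R = bop_id" and R': "R' \<circ>\<^sub>B (Y' - z *\<^sub>C bop_id) = bop_id"
  shows "Y \<circ>\<^sub>B R - Y' \<circ>\<^sub>B R' = (bop_id - Y' \<circ>\<^sub>B R') \<circ>\<^sub>B ((Y - Y') \<circ>\<^sub>B R)"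
proof (rule bop_eqI)
  fix x
  define u where "u = bop_apply R x"
  have x: "bop_apply Y u - z *\<^sub>C u = x" using bop_compose_eq_idD[OF R, of x] by (simp add: u_def)
  have u: "bop_apply R' (bop_apply Y' u - z *\<^sub>C u) = u"
    using bop_compose_eq_idD[OF R', of u] by simp
  have "bop_apply R' (bop_apply Y u - bop_apply Y' u)
      = bop_apply R' ((bop_apply Y u - z *\<^sub>C u) - (bop_apply Y' u - z *\<^sub>C u))" by simp
  also have "\<dots> = bop_apply R' x - u" by (simp only: x bop_apply_linear(2)[of R' x] u)
  finally have "bop_apply R' (bop_apply Y u - bop_apply Y' u) = bop_apply R' x - u" .
  then show "bop_apply (Y \<circ>\<^sub>B R - Y' \<circ>\<^sub>B R') x
      = bop_apply ((bop_id - Y' \<circ>\<^sub>B R') \<circ>\<^sub>B ((Y - Y') \<circ>\<^sub>B R)) x"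
    by (simp add: u_def[symmetric], simp add: bop_apply_linear(2))
qed

lemma borel_measurable_indicator_half_line:
  fixes g :: "real \<Rightarrow> real"
  assumes "continuous_on {0<..} g"
  shows "(\<lambda>t. indicator {0<..} t *\<^sub>R g t) \<in> borel_measurable lborel"
    and "(\<lambda>t. ennreal (g t) * indicator {0<..} t) \<in> borel_measurable lborel"
proof -
  show m: "(\<lambda>t. indicator {0<..} t *\<^sub>R g t) \<in> borel_measurable lborel"
    using borel_measurable_continuous_on_indicator[OF _ assms] by simp
  have "(\<lambda>t. ennreal (indicator {0<..} t *\<^sub>R g t)) \<in> borel_measurable lborel"
    by (rule measurable_compose[OF m]) simp
  also have "(\<lambda>t. ennreal (indicator {0<..} t *\<^sub>R g t)) = (\<lambda>t. ennreal (g t) * indicator {0<..} t)"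
    by (auto simp: indicator_def)
  finally show "(\<lambda>t. ennreal (g t) * indicator {0<..} t) \<in> borel_measurable lborel" .
qed

lemma set_integrable_of_nn_integral:
  fixes g :: "real \<Rightarrow> real"
  assumes g: "continuous_on {0<..} g" and nn: "\<And>t. g t \<ge> 0"
    and fin: "(\<integral>\<^sup>+t\<in>{0<..}. ennreal (g t) \<partial>lborel) < \<infinity>"
  shows "set_integrable lborel {0<..} g"
    and "(LINT t:{0<..}|lborel. g t) = enn2real (\<integral>\<^sup>+t\<in>{0<..}. ennreal (g t) \<partial>lborel)"
proof -
  note m = borel_measurable_indicator_half_line(1)[OF g]
  have eq: "ennreal (indicator {0<..} t *\<^sub>R g t) = ennreal (g t) * indicator {0<..} t" for t
    by (simp add: indicator_def)
  show "set_integrable lborel {0<..} g"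
    unfolding set_integrable_def
  proof (rule integrableI_bounded[OF m])
    have "norm (indicator {0<..} t *\<^sub>R g t) = indicator {0<..} t *\<^sub>R g t" for t
      using nn by (simp add: indicator_def)
    then show "(\<integral>\<^sup>+ t. ennreal (norm (indicator {0<..} t *\<^sub>R g t)) \<partial>lborel) < \<infinity>"
      using fin by (simp only: eq)
  qed
  show "(LINT t:{0<..}|lborel. g t) = enn2real (\<integral>\<^sup>+t\<in>{0<..}. ennreal (g t) \<partial>lborel)"
  proof -
    have "AE t in lborel. 0 \<le> indicator {0<..} t *\<^sub>R g t" using nn by simp
    then show ?thesis
      unfolding set_lebesgue_integral_def by (simp only: integral_eq_nn_integral[OF m] eq)
  qed
qed

section \<open>The transformation \<open>V\<^sub>1\<close> on small balls\<close>

text \<open>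
  The analytic core of the problem: a symmetric operator \<open>A\<close> with real spectrum, and a
  \<open>K\<^sub>B\<close>-bounded curve \<open>\<gamma>\<close>, separated from the spectrum, along which \<open>K'\<close> is continuous. Of the arc length
  parametrisation only the Lipschitz constant \<open>1\<close> matters. Continuity is required off the initial point only, where \<open>K'\<close> may be singular.
\<close>

locale separated_contour =
  fixes A :: "('h::complex_hilbert_space, 'h) bop" and K' :: "complex \<Rightarrow> ('h, 'h) bop"
    and \<gamma> :: "real \<Rightarrow> complex"
  assumes sym: "\<And>x y. cinner (bop_apply A x) y = cinner x (bop_apply A y)"
    and real: "spectrum A \<subseteq> range complex_of_real"
    and gap: "d\<^sub>0 \<gamma> A > 0"
    and lip: "1-lipschitz_on {0..} \<gamma>"
    and cont: "continuous_on {0<..} (\<lambda>t. K' (\<gamma> t))"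
    and K_bounded: "K_B_bounded K' \<gamma>"
begin

abbreviation "d \<equiv> d\<^sub>0 \<gamma> A"
abbreviation "V \<equiv> Var K' \<gamma> A"
abbreviation "\<rho> t \<equiv> infdist (\<gamma> t) (spectrum A)"

abbreviation integrand :: "('h, 'h) bop \<Rightarrow> complex \<Rightarrow> ('h, 'h) bop" where
  "integrand X \<mu> \<equiv> K' \<mu> \<circ>\<^sub>B ((A + X) \<circ>\<^sub>B bop_inverse (A + X - \<mu> *\<^sub>C bop_id))"

lemma spectrum_nonempty: "spectrum A \<noteq> {}"
  using gap unfolding d\<^sub>0_def by auto

lemma gap_le: "t \<ge> 0 \<Longrightarrow> d \<le> \<rho> t"
  unfolding d\<^sub>0_def infdist_eq_setdist by (subst setdist_sym) (auto intro!: setdist_subset_left)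

lemma continuous_\<gamma>: "continuous_on {0<..} \<gamma>"
  by (rule continuous_on_subset[OF lipschitz_on_continuous_on[OF lip]]) auto

lemma norm_le_infdist: "cmod z - norm A \<le> infdist z (spectrum A)"
proof -
  have "cmod z - norm A \<le> (INF l\<in>spectrum A. dist z l)"
  proof (rule cINF_greatest[OF spectrum_nonempty])
    fix l assume "l \<in> spectrum A"
    then show "cmod z - norm A \<le> dist z l"
      using spectrum_norm_le[of l A] norm_triangle_ineq2[of z l] by (simp add: dist_norm)
  qed
  then show ?thesis by (simp add: infdist_notempty[OF spectrum_nonempty])
qed

text \<open>
  The variation is finite, as \<open>dist(\<mu>, \<sigma>(A))\<close> dominates a multiple of \<open>1 + \<bar>\<mu>\<bar>\<close> on the contour: it is at
  least \<open>d\<close>, and at least \<open>\<bar>\<mu>\<bar> - \<parallel>A\<parallel>\<close>. So \<^const>\<open>Var\<close>, which is \<open>0\<close> when the integral diverges, is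
  the true value of the integral.
\<close>

lemma Var_integral:
  shows "set_integrable lborel {0<..} (\<lambda>t. norm (K' (\<gamma> t)) / \<rho> t)"
    and "(LINT t:{0<..}|lborel. norm (K' (\<gamma> t)) / \<rho> t) = V"
proof -
  have pos: "\<rho> t > 0" if "t > 0" for t using gap_le[of t] gap that by simp
  have c: "continuous_on {0<..} (\<lambda>t. norm (K' (\<gamma> t)) / \<rho> t)"
    by (intro continuous_intros cont continuous_\<gamma>) (use pos in force)
  define C where "C = (1 + norm A) / d + 1"
  have C: "C \<ge> 0" using gap by (simp add: C_def)
  have le: "norm (K' (\<gamma> t)) / \<rho> t \<le> C * (norm (K' (\<gamma> t)) / (1 + cmod (\<gamma> t)))" if t: "t > 0" for t
  proof -
    have "1 + cmod (\<gamma> t) \<le> (1 + norm A) * 1 + \<rho> t" using norm_le_infdist[of "\<gamma> t"] by simp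
    also have "\<dots> \<le> (1 + norm A) * (\<rho> t / d) + \<rho> t"
      using gap gap_le[of t] t by (intro add_right_mono mult_left_mono) auto
    also have "\<dots> = C * \<rho> t" by (simp add: C_def algebra_simps)
    finally have "1 / \<rho> t \<le> C / (1 + cmod (\<gamma> t))"
      using pos[OF t] by (simp add: field_simps add_pos_nonneg)
    from mult_left_mono[OF this, of "norm (K' (\<gamma> t))"] show ?thesis by (simp add: mult.commute)
  qed
  have "(\<integral>\<^sup>+t\<in>{0<..}. ennreal (norm (K' (\<gamma> t)) / \<rho> t) \<partial>lborel)
      \<le> (\<integral>\<^sup>+t. ennreal C * (ennreal (norm (K' (\<gamma> t)) / (1 + cmod (\<gamma> t))) * indicator {0<..} t) \<partial>lborel)"
  proof (rule nn_integral_mono)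
    fix t
    show "ennreal (norm (K' (\<gamma> t)) / \<rho> t) * indicator {0<..} t
        \<le> ennreal C * (ennreal (norm (K' (\<gamma> t)) / (1 + cmod (\<gamma> t))) * indicator {0<..} t)"
      using le[of t] C by (cases "t > 0") (auto simp flip: ennreal_mult intro: ennreal_leI)
  qed
  also have "\<dots> = ennreal C * arc_integral \<gamma> (\<lambda>\<mu>. norm (K' \<mu>) / (1 + cmod \<mu>))"
    unfolding arc_integral_def
  proof (rule nn_integral_cmult)
    have "1 + cmod z \<noteq> 0" for z using norm_ge_zero[of z] by linarith
    then have "continuous_on {0<..} (\<lambda>t. norm (K' (\<gamma> t)) / (1 + cmod (\<gamma> t)))"
      by (intro continuous_intros cont continuous_\<gamma>) auto
    then show "(\<lambda>t. ennreal (norm (K' (\<gamma> t)) / (1 + cmod (\<gamma> t))) * indicator {0<..} t) \<in> borel_measurable lborel"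
      by (rule borel_measurable_indicator_half_line(2))
  qed
  also have "\<dots> < \<infinity>" using K_bounded unfolding K_B_bounded_def by (simp add: ennreal_mult_less_top)
  finally have fin: "(\<integral>\<^sup>+t\<in>{0<..}. ennreal (norm (K' (\<gamma> t)) / \<rho> t) \<partial>lborel) < \<infinity>" .
  show "set_integrable lborel {0<..} (\<lambda>t. norm (K' (\<gamma> t)) / \<rho> t)"
    by (rule set_integrable_of_nn_integral(1)[OF c _ fin]) (simp add: infdist_nonneg)
  show "(LINT t:{0<..}|lborel. norm (K' (\<gamma> t)) / \<rho> t) = V"
    unfolding Var_def arc_integral_def
    by (rule set_integrable_of_nn_integral(2)[OF c _ fin]) (simp add: infdist_nonneg)
qed

lemma Var_nonneg: "V \<ge> 0"
  by (simp add: Var_def)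

text \<open>
  An integrand dominated by a multiple of \<open>\<parallel>K'(\<mu>)\<parallel> / dist(\<mu>, \<sigma>(A))\<close> is integrable along the contour,
  and the integral is bounded by the same multiple of the variation.
\<close>

lemma improper_integral_bound:
  fixes F :: "complex \<Rightarrow> ('h, 'h) bop"
  assumes F: "continuous_on {0<..} (\<lambda>t. F (\<gamma> t))" and c: "c \<ge> 0"
    and le: "\<And>t. t > 0 \<Longrightarrow> norm (F (\<gamma> t)) \<le> c * (norm (K' (\<gamma> t)) / \<rho> t)"
  shows "\<exists>I. has_improper_line_integral F I \<gamma>"
    and "has_improper_line_integral F I \<gamma> \<Longrightarrow> norm I \<le> c * V"
proof -
  have cg: "set_integrable lborel {0<..} (\<lambda>t. c * (norm (K' (\<gamma> t)) / \<rho> t))"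
    by (rule set_integrable_mult_right) (rule Var_integral(1))
  have F': "set_integrable lborel {0<..} (\<lambda>t. norm (F (\<gamma> t)))"
  proof (rule set_integrable_bound[OF cg])
    show "set_borel_measurable lborel {0<..} (\<lambda>t. norm (F (\<gamma> t)))"
      unfolding set_borel_measurable_def
      by (rule borel_measurable_indicator_half_line(1)[OF continuous_on_norm[OF F]])
    show "AE t in lborel. t \<in> {0<..} \<longrightarrow> norm (norm (F (\<gamma> t))) \<le> norm (c * (norm (K' (\<gamma> t)) / \<rho> t))"
    proof (rule AE_I2, rule impI)
      fix t :: real assume "t \<in> {0<..}"
      then have "norm (F (\<gamma> t)) \<le> c * (norm (K' (\<gamma> t)) / \<rho> t)" using le by simp
      then show "norm (norm (F (\<gamma> t))) \<le> norm (c * (norm (K' (\<gamma> t)) / \<rho> t))"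
        unfolding real_norm_def abs_norm_cancel by (rule order_trans[OF _ abs_ge_self])
    qed
  qed
  show "\<exists>I. has_improper_line_integral F I \<gamma>"
    using has_improper_line_integral_exists[OF lip F F'] by blast
  have "(LINT t:{0<..}|lborel. norm (F (\<gamma> t))) \<le> (LINT t:{0<..}|lborel. c * (norm (K' (\<gamma> t)) / \<rho> t))"
    by (rule set_integral_mono[OF F' cg]) (use le in auto)
  also have "\<dots> = c * V" by (subst set_integral_mult_right) (simp only: Var_integral(2))
  finally show "norm I \<le> c * V" if "has_improper_line_integral F I \<gamma>"
    using norm_improper_line_integral_le[OF lip F F' that] by simp
qed

context
  fixes r :: real
  assumes r: "r < d"
begin

lemma resolvent:
  assumes X: "norm X \<le> r" and t: "t \<ge> 0"
  defines "R \<equiv> bop_inverse (A + X - \<gamma> t *\<^sub>C bop_id)"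
  shows "R \<circ>\<^sub>B (A + X - \<gamma> t *\<^sub>C bop_id) = bop_id" "(A + X - \<gamma> t *\<^sub>C bop_id) \<circ>\<^sub>B R = bop_id"
    and "norm R \<le> 1 / (\<rho> t - r)"
proof -
  have lt: "r < \<rho> t" using gap_le[OF t] r by simp
  then have "norm X < \<rho> t" using X by simp
  note pr = perturbed_resolvent[OF sym real this, folded R_def]
  show "R \<circ>\<^sub>B (A + X - \<gamma> t *\<^sub>C bop_id) = bop_id" "(A + X - \<gamma> t *\<^sub>C bop_id) \<circ>\<^sub>B R = bop_id"
    by (rule pr)+
  have "1 / (\<rho> t - norm X) \<le> 1 / (\<rho> t - r)" using X lt by (intro frac_le) auto
  with pr(3) show "norm R \<le> 1 / (\<rho> t - r)" by simp
qed

lemma continuous_on_integrand: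
  assumes X: "norm X \<le> r"
  shows "continuous_on {0<..} (\<lambda>t. integrand X (\<gamma> t))"
proof -
  define R where "R t = bop_inverse (A + X - \<gamma> t *\<^sub>C bop_id)" for t
  define L where "L = 1 / (d - r)"
  have L: "L > 0" using r by (simp add: L_def)
  have Rn: "norm (R t) \<le> L" if "t \<ge> 0" for t
  proof -
    have "1 / (\<rho> t - r) \<le> L" unfolding L_def using r gap_le[OF that] by (intro frac_le) auto
    with resolvent(3)[OF X that] show ?thesis by (simp add: R_def)
  qed
  have "(L * L)-lipschitz_on {0<..} R"
  proof (rule lipschitz_onI)
    fix s t :: real assume "s \<in> {0<..}" "t \<in> {0<..}"
    then have st: "s \<ge> 0" "t \<ge> 0" by auto
    have "R s - R t = (\<gamma> s - \<gamma> t) *\<^sub>C (R s \<circ>\<^sub>B R t)"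
      unfolding R_def by (rule resolvent_identity[OF resolvent(1)[OF X st(1)] resolvent(2)[OF X st(2)]])
    then have "norm (R s - R t) = cmod (\<gamma> s - \<gamma> t) * norm (R s \<circ>\<^sub>B R t)" by (simp add: norm_scaleC)
    also have "\<dots> \<le> dist s t * (L * L)"
    proof (rule mult_mono)
      show "cmod (\<gamma> s - \<gamma> t) \<le> dist s t"
        using lipschitz_onD[OF lip, of s t] st by (simp add: dist_norm)
      have "norm (R s \<circ>\<^sub>B R t) \<le> norm (R s) * norm (R t)" by (rule norm_bop_compose_le)
      also have "\<dots> \<le> L * L" using Rn st L by (intro mult_mono) auto
      finally show "norm (R s \<circ>\<^sub>B R t) \<le> L * L" .
    qed auto
    finally show "dist (R s) (R t) \<le> L * L * dist s t" by (simp add: dist_norm mult.commute)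
  qed (use L in auto)
  then have "continuous_on {0<..} R" by (rule lipschitz_on_continuous_on)
  then show ?thesis
    unfolding R_def by (intro bounded_bilinear.continuous_on[OF bounded_bilinear_bop_compose] cont continuous_on_const)
qed

lemma norm_transform_le:
  assumes X: "norm X \<le> r" and t: "t \<ge> 0"
  shows "norm ((A + X) \<circ>\<^sub>B bop_inverse (A + X - \<gamma> t *\<^sub>C bop_id)) \<le> (norm A + r) / (\<rho> t - r)"
proof -
  have "r < \<rho> t" using gap_le[OF t] r by simp
  have "norm (A + X) \<le> norm A + r" using norm_triangle_ineq[of A X] X by simp
  moreover have "0 \<le> norm A + r"
    using X norm_ge_zero[of X] norm_ge_zero[of A] by linarith
  ultimately have "norm (A + X) * norm (bop_inverse (A + X - \<gamma> t *\<^sub>C bop_id)) \<le> (norm A + r) * (1 / (\<rho> t - r))"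
    by (intro mult_mono resolvent(3)[OF X t]) auto
  then have "norm ((A + X) \<circ>\<^sub>B bop_inverse (A + X - \<gamma> t *\<^sub>C bop_id)) \<le> (norm A + r) * (1 / (\<rho> t - r))"
    by (rule order_trans[OF norm_bop_compose_le])
  then show ?thesis by simp
qed

text \<open>
  The integral defining \<open>V\<^sub>1(A + X)\<close> converges, and the bound uses that \<open>\<rho> / (\<rho> - r)\<close> is decreasing in
  the distance \<open>\<rho> \<ge> d\<close> to the spectrum.
\<close>

lemma V1_props:
  assumes X: "norm X \<le> r"
  shows "has_improper_line_integral (integrand X) (V1 K' \<gamma> (A + X)) \<gamma>"
    and "norm (V1 K' \<gamma> (A + X)) \<le> (norm A + r) * d / (d - r) * V"
proof -
  have r0: "r \<ge> 0" by (rule order_trans[OF norm_ge_zero X])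
  define c where "c = (norm A + r) * d / (d - r)"
  have c: "c \<ge> 0" using r0 r gap by (simp add: c_def)
  have le: "norm (integrand X (\<gamma> t)) \<le> c * (norm (K' (\<gamma> t)) / \<rho> t)" if t: "t > 0" for t
  proof -
    have dt: "d \<le> \<rho> t" using gap_le t by simp
    have "norm (integrand X (\<gamma> t)) \<le> norm (K' (\<gamma> t)) * ((norm A + r) / (\<rho> t - r))"
      using t by (intro order_trans[OF norm_bop_compose_le] mult_left_mono norm_transform_le X) auto
    also have "(norm A + r) / (\<rho> t - r) = (norm A + r) * (1 / (\<rho> t - r))" by simp
    also have "1 / (\<rho> t - r) \<le> d / (d - r) / \<rho> t"
      using dt r gap mult_right_mono[OF dt r0] by (simp add: field_simps)
    then have "norm (K' (\<gamma> t)) * ((norm A + r) * (1 / (\<rho> t - r)))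
        \<le> norm (K' (\<gamma> t)) * ((norm A + r) * (d / (d - r) / \<rho> t))"
      using r0 by (intro mult_left_mono) auto
    also have "\<dots> = c * (norm (K' (\<gamma> t)) / \<rho> t)" by (simp add: c_def)
    finally show ?thesis .
  qed
  obtain I where I: "has_improper_line_integral (integrand X) I \<gamma>"
    using improper_integral_bound(1)[where F = "integrand X", OF continuous_on_integrand[OF X] c] le by blast
  then have "V1 K' \<gamma> (A + X) = I"
    unfolding V1_def by (intro the_equality) (simp, rule has_improper_line_integral_unique)
  with I show h: "has_improper_line_integral (integrand X) (V1 K' \<gamma> (A + X)) \<gamma>" by simp
  show "norm (V1 K' \<gamma> (A + X)) \<le> (norm A + r) * d / (d - r) * V"
    unfolding c_def[symmetric]
    by (rule improper_integral_bound(2)[OF continuous_on_integrand[OF X] c _ h]) (rule le)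
qed

text \<open>
  The Lipschitz constant of \<open>V\<^sub>1(A + X)\<close> in the ball of radius \<open>r\<close>; besides \<open>\<rho> / (\<rho> - r)\<close>, also
  \<open>(\<rho> + \<parallel>A\<parallel>) / (\<rho> - r)\<close> is decreasing in \<open>\<rho>\<close>.
\<close>

lemma V1_lipschitz:
  assumes X: "norm X \<le> r" and Z: "norm Z \<le> r"
  shows "norm (V1 K' \<gamma> (A + X) - V1 K' \<gamma> (A + Z)) \<le> d * (d + norm A) / (d - r)\<^sup>2 * V * norm (X - Z)"
proof -
  have r0: "r \<ge> 0" by (rule order_trans[OF norm_ge_zero X])
  define c where "c = d * (d + norm A) / (d - r)\<^sup>2 * norm (X - Z)"
  have c: "c \<ge> 0" using r0 r gap by (simp add: c_def)
  have le: "norm (integrand X (\<gamma> t) - integrand Z (\<gamma> t)) \<le> c * (norm (K' (\<gamma> t)) / \<rho> t)" if "t > 0" for t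
  proof -
    have t: "t \<ge> 0" using that by simp
    have dt: "d \<le> \<rho> t" using gap_le t by simp
    define R S where "R = bop_inverse (A + X - \<gamma> t *\<^sub>C bop_id)" and "S = bop_inverse (A + Z - \<gamma> t *\<^sub>C bop_id)"
    define a where "a = norm A"
    have "a \<ge> 0" by (simp add: a_def)
    have "(A + X) \<circ>\<^sub>B R - (A + Z) \<circ>\<^sub>B S = (bop_id - (A + Z) \<circ>\<^sub>B S) \<circ>\<^sub>B ((A + X - (A + Z)) \<circ>\<^sub>B R)"
      unfolding R_def S_def by (rule transform_difference[OF resolvent(2)[OF X t] resolvent(1)[OF Z t]])
    also have "norm \<dots> \<le> norm (bop_id - (A + Z) \<circ>\<^sub>B S) * norm ((A + X - (A + Z)) \<circ>\<^sub>B R)"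
      by (rule norm_bop_compose_le)
    also have "\<dots> \<le> (1 + (a + r) / (\<rho> t - r)) * (norm (X - Z) * (1 / (\<rho> t - r)))"
    proof (rule mult_mono)
      show "norm (bop_id - (A + Z) \<circ>\<^sub>B S) \<le> 1 + (a + r) / (\<rho> t - r)"
        using norm_triangle_ineq4[of bop_id "(A + Z) \<circ>\<^sub>B S"] norm_bop_id_le[where 'a = 'h]
          norm_transform_le[OF Z t] by (simp add: S_def a_def)
      have "norm ((A + X - (A + Z)) \<circ>\<^sub>B R) \<le> norm (X - Z) * norm R"
        using norm_bop_compose_le[of "X - Z" R] by simp
      also have "\<dots> \<le> norm (X - Z) * (1 / (\<rho> t - r))"
        unfolding R_def by (intro mult_left_mono resolvent(3)[OF X t]) simp
      finally show "norm ((A + X - (A + Z)) \<circ>\<^sub>B R) \<le> norm (X - Z) * (1 / (\<rho> t - r))" .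
      show "0 \<le> 1 + (a + r) / (\<rho> t - r)" using \<open>a \<ge> 0\<close> r0 dt r by simp
    qed simp
    also have "\<dots> = norm (X - Z) * ((\<rho> t + a) / (\<rho> t - r) * (1 / (\<rho> t - r)))"
      using dt r by (simp add: field_simps)
    also have "\<dots> \<le> norm (X - Z) * ((d + a) / (d - r) * (d / (d - r) / \<rho> t))"
    proof (intro mult_left_mono mult_mono)
      have "0 \<le> (\<rho> t - d) * (a + r)" using dt r0 \<open>a \<ge> 0\<close> by simp
      then have "(\<rho> t + a) * (d - r) \<le> (d + a) * (\<rho> t - r)" by (simp add: algebra_simps)
      then show "(\<rho> t + a) / (\<rho> t - r) \<le> (d + a) / (d - r)"
        using dt r by (simp add: divide_le_eq pos_le_divide_eq)
      show "1 / (\<rho> t - r) \<le> d / (d - r) / \<rho> t"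
        using dt r gap mult_right_mono[OF dt r0] by (simp add: field_simps)
    qed (use dt r gap \<open>a \<ge> 0\<close> in auto)
    also have "\<dots> = c / \<rho> t" by (simp add: c_def a_def power2_eq_square mult.commute)
    finally have "norm ((A + X) \<circ>\<^sub>B R - (A + Z) \<circ>\<^sub>B S) \<le> c / \<rho> t" .
    then have "norm (K' (\<gamma> t)) * norm ((A + X) \<circ>\<^sub>B R - (A + Z) \<circ>\<^sub>B S) \<le> norm (K' (\<gamma> t)) * (c / \<rho> t)"
      by (rule mult_left_mono) simp
    moreover have "integrand X (\<gamma> t) - integrand Z (\<gamma> t) = K' (\<gamma> t) \<circ>\<^sub>B ((A + X) \<circ>\<^sub>B R - (A + Z) \<circ>\<^sub>B S)"
      unfolding R_def S_def by (rule bounded_bilinear.diff_right[OF bounded_bilinear_bop_compose, symmetric])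
    ultimately show ?thesis
      using norm_bop_compose_le[of "K' (\<gamma> t)" "(A + X) \<circ>\<^sub>B R - (A + Z) \<circ>\<^sub>B S"]
      by (simp add: mult.commute)
  qed
  have "norm (V1 K' \<gamma> (A + X) - V1 K' \<gamma> (A + Z)) \<le> c * V"
  proof (rule improper_integral_bound(2)[where F = "\<lambda>\<mu>. integrand X \<mu> - integrand Z \<mu>"])
    show "continuous_on {0<..} (\<lambda>t. integrand X (\<gamma> t) - integrand Z (\<gamma> t))"
      by (intro continuous_on_diff continuous_on_integrand X Z)
    show "has_improper_line_integral (\<lambda>\<mu>. integrand X \<mu> - integrand Z \<mu>)
        (V1 K' \<gamma> (A + X) - V1 K' \<gamma> (A + Z)) \<gamma>"
      by (intro has_improper_line_integral_diff V1_props(1) X Z)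
  qed (rule c, rule le)
  then show ?thesis by (simp add: c_def mult.commute mult.left_commute)
qed

end

end

section \<open>The fixed point\<close>

text \<open>
  \<open>r\<close> is the smaller root of \<open>r\<^sup>2 - d (1 - V) r + d V a = 0\<close>, the quadratic equation which expresses that
  the bound for \<open>\<parallel>V\<^sub>1(A + X)\<parallel>\<close> on the ball of radius \<open>r\<close> equals \<open>r\<close>. The midpoint \<open>p = d (1 - V) / 2\<close> of
  its roots separates \<open>r\<close> from the second bound.
\<close>

lemma radii:
  fixes d V a :: real
  assumes d: "d > 0" and V: "0 \<le> V" "V < 1" and a: "a \<ge> 0"
    and small: "V * a < 1 / 4 * d * (1 - V)\<^sup>2"
  defines "r \<equiv> d * (1 - V) / 2 - sqrt (d\<^sup>2 * (1 - V)\<^sup>2 / 4 - d * V * a)"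
  shows "0 \<le> r" "r < d - sqrt (V * d * (d + a))" "V * d * (a + r) = r * (d - r)"
proof -
  define p where "p = d * (1 - V) / 2"
  define s where "s = sqrt (p\<^sup>2 - d * V * a)"
  have p: "p > 0" using d V by (simp add: p_def)
  have p2: "p\<^sup>2 = d\<^sup>2 * (1 - V)\<^sup>2 / 4" by (simp add: p_def power_mult_distrib power_divide)
  have rp: "r = p - s" by (simp add: r_def p_def[symmetric] s_def p2)
  have "d * (V * a) < d * (1 / 4 * d * (1 - V)\<^sup>2)" by (rule mult_strict_left_mono[OF small d])
  also have "\<dots> = p\<^sup>2" unfolding p2 by (simp add: power2_eq_square[of d])
  finally have lt: "d * V * a < p\<^sup>2" by (simp only: mult.assoc)
  have dVa: "0 \<le> d * V * a" using d V a by simp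
  have s2: "s\<^sup>2 = p\<^sup>2 - d * V * a" using lt by (simp add: s_def)
  have s0: "s \<ge> 0" using lt by (simp add: s_def)
  have "s \<le> p" unfolding s_def using p dVa by (intro real_le_lsqrt) auto
  then show "0 \<le> r" by (simp add: rp)
  have "2 * p = d * (1 - V)" by (simp add: p_def)
  then have "2 * p = d - d * V" by (simp add: right_diff_distrib)
  have "r * (d - r) - V * d * (a + r) = r * (d - d * V) - r\<^sup>2 - d * V * a"
    by (simp add: algebra_simps power2_eq_square)
  also have "\<dots> = r * (2 * p) - r\<^sup>2 - d * V * a" by (simp only: \<open>2 * p = d - d * V\<close>)
  also have "\<dots> = 0" using s2 by (simp add: rp power2_eq_square algebra_simps)
  finally show "V * d * (a + r) = r * (d - r)" by simp
  have "(d - p)\<^sup>2 = p\<^sup>2 + V * d * d"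
    by (simp add: p_def power2_eq_square field_simps)
  then have "V * d * (d + a) < (d - p)\<^sup>2" using lt by (simp add: algebra_simps)
  moreover have "d - p > 0"
  proof -
    have "d * V < d * 1" "0 \<le> d * V" using d V by (simp_all del: mult_1_right)
    then show ?thesis using \<open>2 * p = d - d * V\<close> d by linarith
  qed
  ultimately have "sqrt (V * d * (d + a)) < d - p" by (simp add: real_less_lsqrt)
  then show "r < d - sqrt (V * d * (d + a))" using s0 rp by simp
qed

context separated_contour
begin

lemma contraction_constant:
  assumes r: "0 \<le> r" "r < r_max K' \<gamma> A"
  shows "r < d" "d * (d + norm A) / (d - r)\<^sup>2 * V < 1"
proof -
  let ?q = "V * d * (d + norm A)"
  have q: "?q \<ge> 0" using Var_nonneg gap by simp
  have lt: "sqrt ?q < d - r" using r by (simp add: r_max_def)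
  then show rd: "r < d" using real_sqrt_ge_zero[OF q] by linarith
  have "?q = (sqrt ?q)\<^sup>2" using q by simp
  also have "\<dots> < (d - r)\<^sup>2" using lt q by (intro power_strict_mono) auto
  finally show "d * (d + norm A) / (d - r)\<^sup>2 * V < 1"
    using rd by (simp add: divide_less_eq mult.commute mult.left_commute)
qed

lemma V1_fixed_point_unique:
  assumes r: "r < r_max K' \<gamma> A" and X: "norm X \<le> r" "X = V1 K' \<gamma> (A + X)"
    and Z: "norm Z \<le> r" "Z = V1 K' \<gamma> (A + Z)"
  shows "X = Z"
proof (rule ccontr)
  assume "X \<noteq> Z"
  have "0 \<le> r" by (rule order_trans[OF norm_ge_zero X(1)])
  note cc = contraction_constant[OF this r]
  have "norm (X - Z) \<le> d * (d + norm A) / (d - r)\<^sup>2 * V * norm (X - Z)"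
    using V1_lipschitz[OF cc(1) X(1) Z(1)] X(2) Z(2) by simp
  also have "\<dots> < 1 * norm (X - Z)" using cc(2) \<open>X \<noteq> Z\<close> by (intro mult_strict_right_mono) auto
  finally show False by simp
qed

lemma V1_fixed_point_exists:
  assumes V: "V < 1" and small: "V * norm A < 1 / 4 * d * (1 - V)\<^sup>2"
  obtains X where "norm X \<le> r_min K' \<gamma> A" "X = V1 K' \<gamma> (A + X)"
proof -
  define r where "r = r_min K' \<gamma> A"
  note rad = radii[OF gap Var_nonneg V norm_ge_zero small, folded r_min_def r_max_def, folded r_def]
  note cc = contraction_constant[OF rad(1,2)]
  have "\<exists>!X\<in>cball 0 r. V1 K' \<gamma> (A + X) = X"
  proof (rule Banach_fix)
    show "complete (cball (0 :: ('h, 'h) bop) r)" by (simp add: complete_eq_closed)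
    show "cball (0 :: ('h, 'h) bop) r \<noteq> {}" using rad(1) by simp
    show "d * (d + norm A) / (d - r)\<^sup>2 * V < 1" by (rule cc(2))
    show "0 \<le> d * (d + norm A) / (d - r)\<^sup>2 * V" using gap Var_nonneg by simp
    show "(\<lambda>X. V1 K' \<gamma> (A + X)) ` cball 0 r \<subseteq> cball 0 r"
    proof clarify
      fix X :: "('h, 'h) bop" assume "X \<in> cball 0 r"
      then have "norm (V1 K' \<gamma> (A + X)) \<le> (norm A + r) * d / (d - r) * V"
        by (intro V1_props(2)[OF cc(1)]) simp
      also have "\<dots> = (V * d * (norm A + r)) / (d - r)" by simp
      also have "\<dots> = r" using cc(1) by (simp add: rad(3))
      finally show "V1 K' \<gamma> (A + X) \<in> cball 0 r" by simp
    qed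
    show "dist (V1 K' \<gamma> (A + X)) (V1 K' \<gamma> (A + Z)) \<le> d * (d + norm A) / (d - r)\<^sup>2 * V * dist X Z"
      if "X \<in> cball 0 r" "Z \<in> cball 0 r" for X Z
      unfolding dist_norm by (rule V1_lipschitz[OF cc(1)]) (use that in auto)
  qed
  then obtain X where "X \<in> cball 0 r" "V1 K' \<gamma> (A + X) = X" by auto
  then show ?thesis by (intro that[of X]) (auto simp: r_def)
qed

end

section \<open>Symmetry and continuity of the data\<close>

text \<open>On the mirror domain, \<open>K'\<close> is determined by the reflection \<open>K'(cnj \<mu>) = K'(\<mu>)\<^sup>*\<close>.\<close>

lemma continued_derivative_continuous:
  assumes K: "continued_derivative K \<alpha> D K'"
  shows "continuous_on D K'" "continuous_on (cnj ` D) K'"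
proof -
  show c: "continuous_on D K'"
    using K unfolding continued_derivative_def by (auto intro: continuous_on_subset)
  have "continuous_on (cnj ` D) (\<lambda>z. adj (K' (cnj z)))"
    by (rule continuous_on_compose2[OF continuous_on_adj[of UNIV]],
        rule continuous_on_compose2[OF c, where f = cnj]) (auto intro!: continuous_intros)
  moreover have "adj (K' (cnj z)) = K' z" if "z \<in> cnj ` D" for z
    using K that unfolding continued_derivative_def by auto
  ultimately show "continuous_on (cnj ` D) K'" by (simp cong: continuous_on_cong)
qed

lemma symmetric_schur_complement:
  fixes A :: "('a::complex_hilbert_space, 'a) bop"
  assumes "adj A = A"
  shows "cinner (bop_apply (A - B \<circ>\<^sub>B adj B) x) y = cinner x (bop_apply (A - B \<circ>\<^sub>B adj B) y)"
proof -
  have "cinner (bop_apply A x) y = cinner x (bop_apply A y)" using cinner_adj[of A x y] assms by simp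
  moreover have "cinner (bop_apply B u) v = cinner u (bop_apply (adj B) v)" for u v
    by (subst (1 2) cinner_commute) (simp add: cinner_adj)
  ultimately show ?thesis by (simp add: cinner_linear cinner_adj)
qed


section \<open>Solvability of the basic equation\<close>

theorem theorem2p1:
  fixes A\<^sub>0 :: "('h0::complex_hilbert_space \<times> 'h0) set"
    and A\<^sub>1 A\<^sub>1' :: "('h1::complex_hilbert_space, 'h1) bop"
    and T\<^sub>0\<^sub>1 :: "('h1 \<times> 'h0) set"
    and T\<^sub>1\<^sub>0 :: "('h0 \<times> 'h1) set"
    and E\<^sub>0 :: "real set \<Rightarrow> ('h0, 'h0) bop"
    and B\<^sub>1\<^sub>0 :: "('h0, 'h1) bop"
    and B\<^sub>0\<^sub>1 :: "('h1, 'h0) bop"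
    and K' :: "complex \<Rightarrow> ('h1, 'h1) bop"
    and D D\<^sub>l :: "complex set"
    and \<gamma> :: "real \<Rightarrow> complex"
    and \<alpha>\<^sub>0 C g :: real
  assumes separable: "separable_space (euclidean :: 'h0 topology)"
      "separable_space (euclidean :: 'h1 topology)"
    and "\<alpha>\<^sub>0 > 0"
    and A0: "op_selfadjoint A\<^sub>0" "\<nexists>A. graph A = A\<^sub>0"
      "op_spectrum A\<^sub>0 = complex_of_real ` {\<alpha>\<^sub>0..}"
    and E0: "spectral_measure_of E\<^sub>0 A\<^sub>0"
      "\<forall>x. absolutely_continuous lborel (spectral_distribution E\<^sub>0 x)"
    and A1: "adj A\<^sub>1 = A\<^sub>1"
    and T01: "is_operator T\<^sub>0\<^sub>1" "densely_defined T\<^sub>0\<^sub>1"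
    and T10: "is_operator T\<^sub>1\<^sub>0" "op_adjoint T\<^sub>0\<^sub>1 = T\<^sub>1\<^sub>0"
      "Domain (spectral_integral E\<^sub>0 sqrt) \<subseteq> Domain T\<^sub>1\<^sub>0"
    and B: "B\<^sub>1\<^sub>0 = B10_of E\<^sub>0 T\<^sub>1\<^sub>0" "B\<^sub>0\<^sub>1 = adj B\<^sub>1\<^sub>0"
    and A1': "A\<^sub>1' = A\<^sub>1 - B\<^sub>1\<^sub>0 \<circ>\<^sub>B B\<^sub>0\<^sub>1" "spectrum A\<^sub>1' \<subseteq> complex_of_real ` {\<alpha>\<^sub>0..}"
    and D: "open D" "simply_connected D" "D \<subseteq> {z. Im z > 0}"
      "complex_of_real ` {\<alpha>\<^sub>0..} \<subseteq> frontier D"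
    and K': "continued_derivative (K_B E\<^sub>0 \<alpha>\<^sub>0 B\<^sub>1\<^sub>0) \<alpha>\<^sub>0 D K'"
    and bound: "C > 0" "-1 < g" "g \<le> 0"
      "\<forall>\<mu>\<in>D \<union> cnj ` D. norm (K' \<mu>) \<le> C * cmod (\<mu> - complex_of_real \<alpha>\<^sub>0) powr g"
    and contour: "D\<^sub>l = D \<or> D\<^sub>l = cnj ` D" "is_contour \<alpha>\<^sub>0 D\<^sub>l \<gamma>" "K_B_bounded K' \<gamma>"
    and "d\<^sub>0 \<gamma> A\<^sub>1' > 0"
    and "Var K' \<gamma> A\<^sub>1' < 1"
    and "Var K' \<gamma> A\<^sub>1' * norm A\<^sub>1' < 1 / 4 * d\<^sub>0 \<gamma> A\<^sub>1' * (1 - Var K' \<gamma> A\<^sub>1')\<^sup>2"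
  shows "(\<forall>r. r_min K' \<gamma> A\<^sub>1' \<le> r \<and> r < r_max K' \<gamma> A\<^sub>1' \<longrightarrow>
      (\<exists>!X. norm X \<le> r \<and> X = V1 K' \<gamma> (A\<^sub>1' + X))) \<and>
    (\<exists>X. norm X \<le> r_min K' \<gamma> A\<^sub>1' \<and> X = V1 K' \<gamma> (A\<^sub>1' + X) \<and>
      (\<forall>r. r_min K' \<gamma> A\<^sub>1' \<le> r \<and> r < r_max K' \<gamma> A\<^sub>1' \<longrightarrow>
        (\<forall>Z. norm Z \<le> r \<and> Z = V1 K' \<gamma> (A\<^sub>1' + Z) \<longrightarrow> Z = X)))"
proof -
  interpret separated_contour A\<^sub>1' K' \<gamma>
  proof
    show "cinner (bop_apply A\<^sub>1' x) y = cinner x (bop_apply A\<^sub>1' y)" for x y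
      unfolding A1'(1) B(2) by (rule symmetric_schur_complement[OF A1])
    show "spectrum A\<^sub>1' \<subseteq> range complex_of_real" using A1'(2) by auto
    show "1-lipschitz_on {0..} \<gamma>"
      using contour(2) unfolding is_contour_def by (intro arc_length_lipschitz) auto
    then have \<gamma>: "continuous_on {0<..} \<gamma>"
      by (rule continuous_on_subset[OF lipschitz_on_continuous_on]) auto
    have K: "continuous_on D\<^sub>l K'"
      using continued_derivative_continuous[OF K'] contour(1) by auto
    have D: "\<gamma> ` {0<..} \<subseteq> D\<^sub>l" using contour(2) unfolding is_contour_def by simp
    show "continuous_on {0<..} (\<lambda>t. K' (\<gamma> t))"
      by (rule continuous_on_compose2[OF K \<gamma> D])
  qed fact+
  obtain X where X: "norm X \<le> r_min K' \<gamma> A\<^sub>1'" "X = V1 K' \<gamma> (A\<^sub>1' + X)"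
    using V1_fixed_point_exists \<open>Var K' \<gamma> A\<^sub>1' < 1\<close>
      \<open>Var K' \<gamma> A\<^sub>1' * norm A\<^sub>1' < 1 / 4 * d\<^sub>0 \<gamma> A\<^sub>1' * (1 - Var K' \<gamma> A\<^sub>1')\<^sup>2\<close> by blast
  have uniq: "Z = X"
    if "r_min K' \<gamma> A\<^sub>1' \<le> r \<and> r < r_max K' \<gamma> A\<^sub>1'" "norm Z \<le> r \<and> Z = V1 K' \<gamma> (A\<^sub>1' + Z)" for r Z
    using that X by (intro V1_fixed_point_unique[of r Z X]) auto
  show ?thesis
  proof (intro conjI allI impI)
    fix r assume r: "r_min K' \<gamma> A\<^sub>1' \<le> r \<and> r < r_max K' \<gamma> A\<^sub>1'"
    show "\<exists>!Z. norm Z \<le> r \<and> Z = V1 K' \<gamma> (A\<^sub>1' + Z)"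
    proof (rule ex1I)
      show "norm X \<le> r \<and> X = V1 K' \<gamma> (A\<^sub>1' + X)" using X r by auto
    qed (rule uniq[OF r])
  next
    show "\<exists>X. norm X \<le> r_min K' \<gamma> A\<^sub>1' \<and> X = V1 K' \<gamma> (A\<^sub>1' + X) \<and>
      (\<forall>r. r_min K' \<gamma> A\<^sub>1' \<le> r \<and> r < r_max K' \<gamma> A\<^sub>1' \<longrightarrow>
        (\<forall>Z. norm Z \<le> r \<and> Z = V1 K' \<gamma> (A\<^sub>1' + Z) \<longrightarrow> Z = X))"
      using X uniq by (intro exI[of _ X]) blast
  qed
qed

end
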